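(* For $n\ge 2$, the number $h(n)$ of centered ascending polyominoes of semi-perimeter $n$ is \[h(n)=\frac{3n-5}{n-1}\binom{2n-5}{n-2},\] with the convention $\binom{-1}{0}=1$ (so $h(2)=1$).
   Context: A polyomino is a finite edge-connected set of unit cells; it is convex if every row and column is a contiguous segment of cells; its semi-perimeter is the width plus the height of its minimal bounding rectangle. A NW-path inside $P$ is a sequence of cells of $P$, consecutive cells sharing an edge, each step going North or West; write $a\nwarrow b$ if such a path exists from $a$ to $b$, let $D_{NW}(a,b)$ be the minimum number of changes of direction over such paths, and $D_{NW}(P)=\max\{D_{NW}(a,b):a\nwarrow b\}$. A convex polyomino is ascending if $D_{NW}(P)\le1$. It is (horizontally) centered if it contains at least one row touching both the left and the right side of its minimal bounding rectangle. *)

theory Defs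
  imports Complex_Main
begin

text \<open>
  The cell \<open>(x, y)\<close> is the unit square with lower left corner \<open>(x, y)\<close>; the first coordinate
  (the column) grows to the East, the second one (the row) grows to the North.
\<close>

type_synonym cell = "int \<times> int"

definition share_edge :: "cell \<Rightarrow> cell \<Rightarrow> bool" where
  "share_edge c d \<longleftrightarrow> \<bar>fst c - fst d\<bar> + \<bar>snd c - snd d\<bar> = 1"

definition edge_connected :: "cell set \<Rightarrow> bool" where
  "edge_connected P \<longleftrightarrow>
     (\<forall>a\<in>P. \<forall>b\<in>P. (a, b) \<in> {(c, d). c \<in> P \<and> d \<in> P \<and> share_edge c d}\<^sup>*)"

definition polyomino :: "cell set \<Rightarrow> bool" where
  "polyomino P \<longleftrightarrow> finite P \<and> P \<noteq> {} \<and> edge_connected P"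

definition contiguous :: "int set \<Rightarrow> bool" where
  "contiguous S \<longleftrightarrow> (\<forall>i\<in>S. \<forall>k\<in>S. {i..k} \<subseteq> S)"

definition convex_polyomino :: "cell set \<Rightarrow> bool" where
  "convex_polyomino P \<longleftrightarrow>
     polyomino P \<and> (\<forall>y. contiguous {x. (x, y) \<in> P}) \<and> (\<forall>x. contiguous {y. (x, y) \<in> P})"

definition min_col :: "cell set \<Rightarrow> int" where "min_col P = Min (fst ` P)"
definition max_col :: "cell set \<Rightarrow> int" where "max_col P = Max (fst ` P)"
definition min_row :: "cell set \<Rightarrow> int" where "min_row P = Min (snd ` P)"
definition max_row :: "cell set \<Rightarrow> int" where "max_row P = Max (snd ` P)"

definition width :: "cell set \<Rightarrow> nat" where
  "width P = nat (max_col P - min_col P + 1)"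

definition height :: "cell set \<Rightarrow> nat" where
  "height P = nat (max_row P - min_row P + 1)"

definition semi_perimeter :: "cell set \<Rightarrow> nat" where
  "semi_perimeter P = width P + height P"

definition north :: "int \<times> int" where "north = (0, 1)"
definition west :: "int \<times> int" where "west = (-1, 0)"

definition steps :: "cell list \<Rightarrow> (int \<times> int) list" where
  "steps p = map2 (\<lambda>c d. (fst d - fst c, snd d - snd c)) p (tl p)"

text \<open>The one-cell sequence is a path, so every cell reaches itself.\<close>

definition NW_path :: "cell set \<Rightarrow> cell list \<Rightarrow> bool" where
  "NW_path P p \<longleftrightarrow> p \<noteq> [] \<and> set p \<subseteq> P \<and> set (steps p) \<subseteq> {north, west}"

definition NW_path_between :: "cell set \<Rightarrow> cell \<Rightarrow> cell \<Rightarrow> cell list \<Rightarrow> bool" where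
  "NW_path_between P a b p \<longleftrightarrow> NW_path P p \<and> hd p = a \<and> last p = b"

definition NW_reaches :: "cell set \<Rightarrow> cell \<Rightarrow> cell \<Rightarrow> bool" where
  "NW_reaches P a b \<longleftrightarrow> (\<exists>p. NW_path_between P a b p)"

definition direction_changes :: "cell list \<Rightarrow> nat" where
  "direction_changes p =
     card {i. Suc i < length (steps p) \<and> steps p ! i \<noteq> steps p ! Suc i}"

definition D_NW_between :: "cell set \<Rightarrow> cell \<Rightarrow> cell \<Rightarrow> nat" where
  "D_NW_between P a b = (LEAST k. \<exists>p. NW_path_between P a b p \<and> direction_changes p = k)"

definition D_NW :: "cell set \<Rightarrow> nat" where
  "D_NW P = Max {D_NW_between P a b | a b. NW_reaches P a b}"

definition ascending :: "cell set \<Rightarrow> bool" where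
  "ascending P \<longleftrightarrow> convex_polyomino P \<and> D_NW P \<le> 1"

definition centered :: "cell set \<Rightarrow> bool" where
  "centered P \<longleftrightarrow> (\<exists>y. (min_col P, y) \<in> P \<and> (max_col P, y) \<in> P)"

text \<open>Polyominoes are counted up to translation.\<close>

definition translate :: "int \<times> int \<Rightarrow> cell set \<Rightarrow> cell set" where
  "translate v P = (\<lambda>c. (fst c + fst v, snd c + snd v)) ` P"

definition translation_equiv :: "(cell set \<times> cell set) set" where
  "translation_equiv = {(P, Q). \<exists>v. Q = translate v P}"

definition h :: "nat \<Rightarrow> nat" where
  "h n = card ({P. ascending P \<and> centered P \<and> semi_perimeter P = n} // translation_equiv)"

end

theory Submission
  imports Defs
begin

text \<open>
  Translate so that the lowest full row is row 0. The rows above it form a nested list \<open>I\<close> of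
  intervals, the rows below a nested list \<open>J\<close>, and an NW-pair joined by no path with one turn
  exists iff some interval of \<open>I\<close> has both ends strictly to the left of those of an interval of \<open>J\<close>.

  Let \<open>N\<^sub>k(a, b)\<close> count the pairs without this pattern, with \<open>I\<close> in \<open>a\<close> columns, \<open>J\<close> in \<open>b\<close>
  columns and \<open>k\<close> rows in total. Removing rows whose left end is leftmost gives recurrences for
  \<open>N\<close> whose characteristic polynomial factors: if \<open>\<alpha>\<close>, \<open>\<beta>\<close>, \<open>t\<close> lower \<open>a\<close>, \<open>b\<close>, \<open>k\<close> by one, it
  is \<open>(t - (1 - \<alpha>) (1 - \<beta>)) (t - (1 - \<alpha> \<beta>))\<close>. Hence \<open>X = (1 - \<alpha> \<beta> - t) N\<close> satisfies
  \<open>(1 - \<alpha>) (1 - \<beta>) X = t X\<close>, which the reflection principle solves by two products of multiset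
  coefficients \<open>E\<^sub>k(a)\<close> (the number of multisets of size \<open>k\<close> from \<open>a\<close> elements) plus an
  antisymmetric sum of such products. Next to the diagonal that sum telescopes, and
  \<open>N\<^sub>k(a, a) = E\<^sub>k(a) E\<^sub>k(a + 1)\<close> follows.

  This number counts the polyominoes of width \<open>a\<close> and height \<open>k + 1\<close> with a marked full row; by
  Vandermonde the number with semi-perimeter \<open>m + 1\<close> is \<open>(2 m - 1) choose m\<close>. Since the full
  rows of a polyomino are consecutive, subtracting those with two marked consecutive full rows
  leaves \<open>h n = ((2 n - 3) choose (n - 1)) - ((2 n - 5) choose (n - 2))\<close>.
\<close>

subsection \<open>Nested interval lists and their recurrences\<close>

definition inside :: "int \<times> int \<Rightarrow> int \<times> int \<Rightarrow> bool" where
  "inside p q \<longleftrightarrow> fst p \<le> fst q \<and> snd q \<le> snd p"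

text \<open>Lists are read away from the full row, so every interval contains the later ones; the
  available columns are \<open>i\<close>, ..., \<open>a - 1\<close>.\<close>

definition nested_in :: "int \<Rightarrow> int \<Rightarrow> (int \<times> int) list \<Rightarrow> bool" where
  "nested_in i a L \<longleftrightarrow> sorted_wrt inside L \<and> (\<forall>p\<in>set L. i \<le> fst p \<and> fst p \<le> snd p \<and> snd p < a)"

definition compatible :: "(int \<times> int) list \<Rightarrow> (int \<times> int) list \<Rightarrow> bool" where
  "compatible I J \<longleftrightarrow> (\<forall>p\<in>set I. \<forall>q\<in>set J. fst p < fst q \<longrightarrow> snd q \<le> snd p)"

text \<open>The left bounds are separate parameters because the recursion strips column 0 first from
  \<open>J\<close> and then from \<open>I\<close>, passing through the state \<open>i = 0\<close>,
  \<open>j = 1\<close>.\<close>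

definition stack_pairs ::
  "int \<Rightarrow> int \<Rightarrow> int \<Rightarrow> int \<Rightarrow> nat \<Rightarrow> ((int \<times> int) list \<times> (int \<times> int) list) set" where
  "stack_pairs i a j b k =
     {(I, J). nested_in i a I \<and> nested_in j b J \<and> compatible I J \<and> length I + length J = k}"

lemma nested_in_Nil [simp]: "nested_in i a []"
  by (simp add: nested_in_def)

lemma nested_in_Cons:
  "nested_in i a (p # L) \<longleftrightarrow>
     i \<le> fst p \<and> fst p \<le> snd p \<and> snd p < a \<and> nested_in (fst p) (snd p + 1) L"
  by (fastforce simp: nested_in_def inside_def)

lemma nested_in_mono: "nested_in i a L \<Longrightarrow> i' \<le> i \<Longrightarrow> a \<le> a' \<Longrightarrow> nested_in i' a' L"
  by (fastforce simp: nested_in_def)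

lemma finite_stack_pairs: "finite (stack_pairs i a j b k)"
proof -
  have "stack_pairs i a j b k \<subseteq>
    {I. set I \<subseteq> {i..a} \<times> {i..a} \<and> length I \<le> k} \<times> {J. set J \<subseteq> {j..b} \<times> {j..b} \<and> length J \<le> k}"
    by (fastforce simp: stack_pairs_def nested_in_def)
  moreover have "finite \<dots>"
    by (intro finite_cartesian_product finite_lists_length_le) auto
  ultimately show ?thesis by (rule finite_subset)
qed

text \<open>The first interval contains all the others, so if it does not start in column
  \<open>i\<close>, none of them does.\<close>

lemma nested_in_split_first:
  assumes "nested_in i a L"
  shows "nested_in (i + 1) a L \<or> (\<exists>r L'. L = (i, r) # L' \<and> i \<le> r \<and> r < a \<and> nested_in i (r + 1) L')"
proof (cases L)
  case (Cons p L')
  with assms show ?thesis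
    by (cases "fst p = i"; cases p) (auto simp: nested_in_Cons)
qed simp

definition pair_count :: "nat \<Rightarrow> nat \<Rightarrow> nat \<Rightarrow> int" where
  "pair_count k a b = int (card (stack_pairs 0 (int a) 0 (int b) k))"

definition pair_count_indented :: "nat \<Rightarrow> nat \<Rightarrow> nat \<Rightarrow> int" where
  "pair_count_indented k a b = int (card (stack_pairs 0 (int a) 1 (int b) k))"

lemma stack_pairs_0: "stack_pairs i a j b 0 = {([], [])}"
  by (auto simp: stack_pairs_def compatible_def)

lemma pair_count_0 [simp]: "pair_count 0 a b = 1" and pair_count_indented_0 [simp]:
    "pair_count_indented 0 a b = 1"
  by (simp_all add: pair_count_def pair_count_indented_def stack_pairs_0)

lemma card_split:
  fixes g :: "nat \<Rightarrow> 'b \<Rightarrow> 'a"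
  assumes "S = T \<union> (\<Union>r<m. g r ` U r)" "finite T" "\<And>r. r < m \<Longrightarrow> finite (U r)"
    and "\<And>r. r < m \<Longrightarrow> inj_on (g r) (U r)"
    and "\<And>r u. r < m \<Longrightarrow> u \<in> U r \<Longrightarrow> g r u \<notin> T"
    and "\<And>r r' u u'. g r u = g r' u' \<Longrightarrow> r = r'"
  shows "int (card S) = int (card T) + (\<Sum>r<m. int (card (U r)))"
proof -
  have "card S = card T + card (\<Union>r<m. g r ` U r)"
    unfolding assms(1) using assms by (intro card_Un_disjoint) auto
  also have "card (\<Union>r<m. g r ` U r) = (\<Sum>r<m. card (g r ` U r))"
    using assms by (intro card_UN_disjoint) (auto dest: assms(6))
  also have "\<dots> = (\<Sum>r<m. card (U r))"
    using assms(4) by (intro sum.cong refl card_image) auto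
  finally show ?thesis by simp
qed

text \<open>Either no interval of \<open>J\<close> starts in column 0, or the first one is some
  \<open>(0, r)\<close>. The latter never takes part in the forbidden pattern, because nothing in
  \<open>I\<close> starts left of column 0, so it can be removed freely.\<close>

lemma pair_count_Suc: "pair_count (Suc k) a b = pair_count_indented (Suc k) a b
    + (\<Sum>r<b. pair_count k a (Suc r))"
  unfolding pair_count_def pair_count_indented_def
proof (rule card_split[where g = "\<lambda>r (I, J). (I, (0, int r) # J)"])
  show "stack_pairs 0 (int a) 0 (int b) (Suc k) = stack_pairs 0 (int a) 1 (int b) (Suc k) \<union>
      (\<Union>r<b. (\<lambda>(I, J). (I, (0, int r) # J)) ` stack_pairs 0 (int a) 0 (int (Suc r)) k)"
    (is "?S = ?T \<union> ?U")
  proof (intro equalityI subsetI)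
    fix x assume "x \<in> ?S"
    then obtain I J where x: "x = (I, J)" "nested_in 0 (int a) I" "nested_in 0 (int b) J"
      "compatible I J" "length I + length J = Suc k" by (auto simp: stack_pairs_def)
    from nested_in_split_first[OF x(3)] show "x \<in> ?T \<union> ?U"
    proof
      assume "nested_in (0 + 1) (int b) J"
      then show ?thesis using x by (simp add: stack_pairs_def)
    next
      assume "\<exists>r J'. J = (0, r) # J' \<and> 0 \<le> r \<and> r < int b \<and> nested_in 0 (r + 1) J'"
      then obtain r J' where r: "J = (0, r) # J'" "0 \<le> r" "r < int b" "nested_in 0 (r + 1) J'"
        by blast
      then have "(I, J') \<in> stack_pairs 0 (int a) 0 (int (Suc (nat r))) k"
        using x by (auto simp: stack_pairs_def compatible_def algebra_simps)
      then have "x \<in> (\<lambda>(I, J). (I, (0, int (nat r)) # J)) ` stack_pairs 0 (int a) 0 (int (Suc (nat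
          r))) k"
        using x r by (intro image_eqI[where x = "(I, J')"]) simp_all
      moreover have "nat r \<in> {..<b}" using r by auto
      ultimately show ?thesis by (intro UnI2 UN_I)
    qed
  next
    fix x assume "x \<in> ?T \<union> ?U"
    then show "x \<in> ?S"
    proof
      assume "x \<in> ?T"
      then show ?thesis by (auto simp: stack_pairs_def intro: nested_in_mono)
    next
      assume "x \<in> ?U"
      then obtain r I J where r: "r < b" "x = (I, (0, int r) # J)"
        "(I, J) \<in> stack_pairs 0 (int a) 0 (int (Suc r)) k" by auto
      then have "\<forall>p\<in>set I. \<not> fst p < 0"
        by (auto simp: stack_pairs_def nested_in_def not_less)
      then have "compatible I ((0, int r) # J)"
        using r by (simp add: stack_pairs_def compatible_def)
      then show ?thesis
        using r by (auto simp: stack_pairs_def nested_in_Cons add.commute)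
    qed
  qed
qed (rule finite_stack_pairs, rule finite_stack_pairs, auto simp: inj_on_def stack_pairs_def
    nested_in_Cons)

text \<open>All intervals of \<open>J\<close> now start right of column 0, so compatibility with a
  first interval \<open>(0, r)\<close> of \<open>I\<close> means exactly that they end by column
  \<open>r\<close>. This is the source of the \<open>min\<close>.\<close>

lemma pair_count_indented_Suc_aux:
  "int (card (stack_pairs 0 (int a) 1 (int b) (Suc k))) =
     int (card (stack_pairs 1 (int a) 1 (int b) (Suc k)))
         + (\<Sum>r<a. pair_count_indented k (Suc r) (min (Suc r) b))"
  unfolding pair_count_indented_def
proof (rule card_split[where g = "\<lambda>r (I, J). ((0, int r) # I, J)"])
  show "stack_pairs 0 (int a) 1 (int b) (Suc k) = stack_pairs 1 (int a) 1 (int b) (Suc k) \<union>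
      (\<Union>r<a. (\<lambda>(I, J). ((0, int r) # I, J)) `
         stack_pairs 0 (int (Suc r)) 1 (int (min (Suc r) b)) k)"
    (is "?S = ?T \<union> ?U")
  proof (intro equalityI subsetI)
    fix x assume "x \<in> ?S"
    then obtain I J where x: "x = (I, J)" "nested_in 0 (int a) I" "nested_in 1 (int b) J"
      "compatible I J" "length I + length J = Suc k" by (auto simp: stack_pairs_def)
    from nested_in_split_first[OF x(2)] show "x \<in> ?T \<union> ?U"
    proof
      assume "nested_in (0 + 1) (int a) I"
      then show ?thesis using x by (simp add: stack_pairs_def)
    next
      assume "\<exists>r I'. I = (0, r) # I' \<and> 0 \<le> r \<and> r < int a \<and> nested_in 0 (r + 1) I'"
      then obtain r I' where r: "I = (0, r) # I'" "0 \<le> r" "r < int a" "nested_in 0 (r + 1) I'"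
        by blast
      have "\<forall>q\<in>set J. 1 \<le> fst q \<longrightarrow> snd q \<le> r"
        using x(4) r(1) by (simp add: compatible_def)
      then have "nested_in 1 (min (r + 1) (int b)) J"
        using x(3) by (simp add: nested_in_def)
      moreover have "int (min (Suc (nat r)) b) = min (r + 1) (int b)" using r by auto
      ultimately have "(I', J) \<in> stack_pairs 0 (int (Suc (nat r))) 1 (int (min (Suc (nat r)) b)) k"
        using x r by (simp add: stack_pairs_def compatible_def add.commute)
      then have "x \<in> (\<lambda>(I, J). ((0, int (nat r)) # I, J)) `
          stack_pairs 0 (int (Suc (nat r))) 1 (int (min (Suc (nat r)) b)) k"
        using x r by (intro image_eqI[where x = "(I', J)"]) simp_all
      moreover have "nat r \<in> {..<a}" using r by auto
      ultimately show ?thesis by (intro UnI2 UN_I)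
    qed
  next
    fix x assume "x \<in> ?T \<union> ?U"
    then show "x \<in> ?S"
    proof
      assume "x \<in> ?T"
      then show ?thesis by (auto simp: stack_pairs_def intro: nested_in_mono)
    next
      assume "x \<in> ?U"
      then obtain r I J where r: "r < a" "x = ((0, int r) # I, J)"
        "(I, J) \<in> stack_pairs 0 (int (Suc r)) 1 (int (min (Suc r) b)) k" by auto
      then have "nested_in 1 (int b) J" by (auto simp: stack_pairs_def intro: nested_in_mono)
      moreover have "\<forall>q\<in>set J. snd q \<le> int r"
        using r(3) by (auto simp: stack_pairs_def nested_in_def)
      ultimately show ?thesis
        using r by (simp add: stack_pairs_def nested_in_Cons compatible_def add.commute)
    qed
  qed
qed (rule finite_stack_pairs, rule finite_stack_pairs, auto simp: inj_on_def stack_pairs_def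
    nested_in_Cons)

section \<open>Translation of interval lists\<close>

definition shift :: "int \<Rightarrow> (int \<times> int) list \<Rightarrow> (int \<times> int) list" where
  "shift c = map (\<lambda>p. (fst p + c, snd p + c))"

lemma shift_shift [simp]: "shift (- c) (shift c L) = L" "shift c (shift (- c) L) = L"
  by (simp_all add: shift_def o_def)

lemma nested_in_shift: "nested_in i a L \<Longrightarrow> nested_in (i + c) (a + c) (shift c L)"
  by (auto simp: nested_in_def shift_def sorted_wrt_map inside_def[abs_def])

lemma compatible_shift: "compatible I J \<Longrightarrow> compatible (shift c I) (shift c J)"
  by (simp add: compatible_def shift_def)

lemma card_stack_pairs_shift:
  "card (stack_pairs (i + c) (a + c) (j + c) (b + c) k) = card (stack_pairs i a j b k)"
proof -
  have *: "map_prod (shift c) (shift c) x \<in> stack_pairs (i + c) (a + c) (j + c) (b + c) k"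
    if "x \<in> stack_pairs i a j b k" for x c i a j b
    using that nested_in_shift compatible_shift
    by (auto simp: stack_pairs_def) (auto simp: shift_def)
  have "bij_betw (map_prod (shift c) (shift c)) (stack_pairs i a j b k)
      (stack_pairs (i + c) (a + c) (j + c) (b + c) k)"
    by (rule bij_betw_byWitness[where f' = "map_prod (shift (- c)) (shift (- c))"])
       (use *[of _ i a j b c] *[of _ "i + c" "a + c" "j + c" "b + c" "- c"]
           in \<open>auto simp: image_subset_iff\<close>)
  then show ?thesis by (simp add: bij_betw_same_card)
qed

text \<open>A range without columns admits only the empty list. This covers \<open>b = 0\<close>
  below, where the truncated \<open>b - 1\<close> does not agree with a shift by one column.\<close>

lemma stack_pairs_empty_range:
  assumes "b \<le> j" "b' \<le> j'"
  shows "stack_pairs i a j b k = stack_pairs i a j' b' k"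
proof -
  have "nested_in j b J \<longleftrightarrow> J = []" if "b \<le> j" for J j b
    using that by (cases J) (auto simp: nested_in_Cons)
  then show ?thesis using assms by (simp add: stack_pairs_def cong: conj_cong)
qed

lemma pair_count_indented_Suc:
  "pair_count_indented (Suc k) (Suc a) b = pair_count (Suc k) a (b - 1)
      + (\<Sum>r<Suc a. pair_count_indented k (Suc r) (min (Suc r) b))"
proof -
  have "card (stack_pairs 1 (int (Suc a)) 1 (int b) (Suc k))
      = card (stack_pairs 0 (int a) 0 (int (b - 1)) (Suc k))"
  proof (cases b)
    case 0
    then have "stack_pairs 1 (int (Suc a)) 1 (int b) (Suc k)
        = stack_pairs 1 (int (Suc a)) 1 1 (Suc k)"
      by (intro stack_pairs_empty_range) auto
    then show ?thesis using card_stack_pairs_shift[of 0 1 "int a" 0 0 "Suc k"] 0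
        by (simp add: add.commute)
  next
    case (Suc c)
    then show ?thesis using card_stack_pairs_shift[of 0 1 "int a" 0 "int c" "Suc k"]
        by (simp add: add.commute)
  qed
  then show ?thesis using pair_count_indented_Suc_aux[of "Suc a" b k]
      by (simp add: pair_count_indented_def pair_count_def)
qed

lemma pair_count_indented_0_right: "pair_count_indented k a 0 = pair_count k a 0"
  by (cases k) (simp_all add: pair_count_Suc)

lemma pair_count_indented_1_right: "pair_count_indented k a (Suc 0) = pair_count k a 0"
proof -
  have "pair_count_indented k a (Suc 0) = pair_count_indented k a 0"
    unfolding pair_count_indented_def by (subst stack_pairs_empty_range[of _ _ "int 0" 1]) auto
  then show ?thesis by (simp add: pair_count_indented_0_right)
qed

lemma nested_in_empty_range: "b \<le> j \<Longrightarrow> nested_in j b J \<longleftrightarrow> J = []"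
  by (cases J) (auto simp: nested_in_Cons)

lemma pair_count_no_columns: "pair_count (Suc k) 0 0 = 0"
proof -
  have "stack_pairs 0 0 0 0 (Suc k) = {}"
    by (simp add: stack_pairs_def nested_in_empty_range)
  then show ?thesis by (simp add: pair_count_def)
qed

subsection \<open>Solution of the recurrences\<close>

text \<open>\<open>multichoose a k\<close> is E_k(a) of the introduction; the recursion asks whether
  a fixed element occurs in the multiset.\<close>

fun multichoose :: "nat \<Rightarrow> nat \<Rightarrow> int" where
  "multichoose n 0 = 1"
| "multichoose 0 (Suc k) = 0"
| "multichoose (Suc n) (Suc k) = multichoose n (Suc k) + multichoose (Suc n) k"

lemma multichoose_binomial: "multichoose (Suc n) k = int ((n + k) choose k)"
proof (induction "n + k" arbitrary: n k)
  case 0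
  then show ?case by simp
next
  case (Suc m)
  show ?case
  proof (cases k)
    case (Suc l)
    show ?thesis
    proof (cases n)
      case 0
      then show ?thesis using Suc.hyps(1)[of 0 l] Suc.hyps(2) Suc by simp
    next
      case (Suc n')
      then show ?thesis
        using Suc.hyps(1)[of n l] Suc.hyps(1)[of n' k] Suc.hyps(2) \<open>k = Suc l\<close>
        by (simp add: add.commute)
    qed
  qed simp
qed

lemma sum_multichoose: "(\<Sum>r<n. multichoose (Suc r) k) = multichoose n (Suc k)"
  by (induction n) auto

text \<open>The ends of \<open>k\<close> nested intervals, left ends first, form one weakly
  increasing sequence of \<open>2 * k\<close> columns.\<close>

lemma pair_count_0_right: "pair_count k a 0 = multichoose a (2 * k)"
proof (induction k arbitrary: a)
  case (Suc k)
  show ?case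
  proof (induction a)
    case 0
    then show ?case by (simp add: pair_count_no_columns)
  next
    case (Suc a)
    have "pair_count (Suc k) (Suc a) 0 = pair_count (Suc k) a 0
        + (\<Sum>r<Suc a. pair_count k (Suc r) 0)"
      using pair_count_indented_Suc[of k a 0] by (simp add: pair_count_indented_0_right)
    also have "(\<Sum>r<Suc a. pair_count k (Suc r) 0) = multichoose (Suc a) (Suc (2 * k))"
      unfolding Suc.IH \<open>\<And>a. pair_count k a 0 = multichoose a (2 * k)\<close> by (rule sum_multichoose)
    finally show ?case using Suc by simp
  qed
qed simp

section \<open>Difference equations and boundary values\<close>

lemma pair_count_step: "pair_count (Suc k) a (Suc b) - pair_count (Suc k) a b
    = pair_count_indented (Suc k) a (Suc b) - pair_count_indented (Suc k) a b
        + pair_count k a (Suc b)"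
  by (simp add: pair_count_Suc)

text \<open>Subtracting the sums for consecutive widths leaves the last term, in which the
  assumption makes the \<open>min\<close> equal to \<open>b\<close>.\<close>

lemma pair_count_indented_step:
  assumes "b \<le> Suc a"
  shows "pair_count_indented (Suc k) (Suc (Suc a)) b - pair_count_indented (Suc k) (Suc a) b
    = pair_count (Suc k) (Suc a) (b - 1) - pair_count (Suc k) a (b - 1)
        + pair_count_indented k (Suc (Suc a)) b"
  using assms by (simp add: pair_count_indented_Suc min_def)

text \<open>Letting \<open>b\<close> grow together with \<open>a\<close> does not disturb the
  earlier terms: for \<open>r < Suc a\<close> the \<open>min\<close> is \<open>Suc r\<close> in both
  sums.\<close>

lemma pair_count_indented_step_diag:
  "pair_count_indented (Suc k) (Suc (Suc a)) (Suc (Suc a)) - pair_count_indented (Suc k) (Suc a)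
      (Suc a)
    = pair_count (Suc k) (Suc a) (Suc a) - pair_count (Suc k) a a
        + pair_count_indented k (Suc (Suc a)) (Suc (Suc a))"
proof -
  have "(\<Sum>r<Suc a. pair_count_indented k (Suc r) (min (Suc r) (Suc (Suc a))))
      = (\<Sum>r<Suc a. pair_count_indented k (Suc r) (min (Suc r) (Suc a)))"
    by (intro sum.cong refl) (auto simp: min_def)
  then show ?thesis by (simp add: pair_count_indented_Suc[of k "Suc a"] pair_count_indented_Suc[of
      k a])
qed

text \<open>This is the function \<open>X\<close> of the introduction.\<close>

definition increment :: "nat \<Rightarrow> nat \<Rightarrow> nat \<Rightarrow> int" where
  "increment k a b = pair_count k a b - pair_count k (a - 1) (b - 1) - (if k
      = 0 then 0 else pair_count (k - 1) a b)"

lemma increment_0: "increment 0 a b = 0"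
  by (simp add: increment_def)

text \<open>This is the equation \<open>(1 - \<alpha>) (1 - \<beta>) X = t X\<close>, obtained by
  eliminating \<open>pair_count_indented\<close> from the difference equations. The assumption keeps
  all four points in the region where the second width is at most the first.\<close>

lemma increment_bulk:
  assumes "Suc (Suc b) \<le> Suc a"
  shows "increment (Suc k) (Suc (Suc a)) (Suc (Suc b)) = increment (Suc k) (Suc a) (Suc (Suc b))
    + increment (Suc k) (Suc (Suc a)) (Suc b) - increment (Suc k) (Suc a) (Suc b)
        + increment k (Suc (Suc a)) (Suc (Suc b))"
proof -
  note f = pair_count_step[of k "Suc (Suc a)" "Suc b"] pair_count_step[of k "Suc a" "Suc b"]
    pair_count_indented_step[of "Suc (Suc b)" a k] pair_count_indented_step[of "Suc b" a k]
  show ?thesis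
  \<comment> \<open>A difference of \<open>pair_count_indented\<close> at level \<open>k\<close> is
    left over. It vanishes for \<open>k = 0\<close>; otherwise \<open>pair_count_step\<close> one
    level lower removes it.\<close>
  proof (cases k)
    case 0
    then show ?thesis using f assms by (simp add: increment_def)
  next
    case (Suc l)
    then show ?thesis using f pair_count_step[of l "Suc (Suc a)" "Suc b"] assms
        by (simp add: increment_def)
  qed
qed

text \<open>Starting value for the induction on the second width: an indented \<open>J\<close> has
  no columns when \<open>b\<close> is 0 or 1, so everything reduces to
  \<open>pair_count_0_right\<close>.\<close>

lemma increment_one: "increment (Suc k) (Suc a) (Suc 0) = multichoose (Suc a) (Suc (2 * k))"
proof -
  have "pair_count (Suc k) (Suc a) (Suc 0) - pair_count k (Suc a) (Suc 0)
      = pair_count (Suc k) (Suc a) 0"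
    using pair_count_step[of k "Suc a" 0] by (simp add: pair_count_indented_0_right
        pair_count_indented_1_right)
  then show ?thesis by (simp add: increment_def pair_count_0_right)
qed

text \<open>Boundary condition on the diagonal, where \<open>increment_bulk\<close> does not apply.
  The two steps of \<open>pair_count_indented\<close> start from the same diagonal value, which
  cancels; what remains is a diagonal \<open>pair_count\<close> of smaller width, known by
  induction.\<close>

lemma increment_diag: "increment (Suc k) (Suc (Suc a)) (Suc (Suc a)) =
    increment k (Suc (Suc a)) (Suc (Suc a)) + increment (Suc k) (Suc (Suc a)) (Suc a)
        + pair_count k (Suc a) (Suc a)"
proof -
  note f = pair_count_step[of k "Suc (Suc a)" "Suc a"] pair_count_indented_step[of "Suc a" a k]
      pair_count_indented_step_diag[of k a]
  show ?thesis
  proof (cases k)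
    case 0
    then show ?thesis using f by (simp add: increment_def)
  next
    case (Suc l)
    then show ?thesis using f pair_count_step[of l "Suc (Suc a)" "Suc a"]
      by (simp add: increment_def)
  qed
qed

text \<open>The antisymmetric part of the solution: products of multiset coefficients with sizes
  adding up to \<open>2 * k - 1\<close>, each minus its mirror image under exchange of
  \<open>a\<close> and \<open>c\<close>.\<close>

definition skew :: "nat \<Rightarrow> nat \<Rightarrow> nat \<Rightarrow> int" where
  "skew k a c = (\<Sum>j<k. multichoose a (2 * k - 1 - j) * multichoose c j
                     - multichoose a j * multichoose c (2 * k - 1 - j))"

lemma skew_antisym: "skew k a c = - skew k c a"
  unfolding skew_def sum_negf[symmetric] by (intro sum.cong refl) simp

lemma skew_0 [simp]: "skew 0 a c = 0"
  by (simp add: skew_def)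

lemma skew_same [simp]: "skew k a a = 0"
  using skew_antisym[of k a a] by simp

lemma skew_no_columns: "skew (Suc k) a 0 = multichoose a (Suc (2 * k))"
proof -
  have *: "multichoose 0 j = (if j = 0 then 1 else 0)" for j by (cases j) auto
  have "skew (Suc k) a 0 = (\<Sum>j<Suc k. if j = 0 then multichoose a (Suc (2 * k)) else 0)"
    unfolding skew_def by (intro sum.cong refl) (auto simp: *)
  then show ?thesis by (simp only: sum.delta) simp
qed

text \<open>Differencing in one argument lowers the size of that multiset coefficient by one.
  Differencing in both arguments therefore turns summand \<open>j + 1\<close> at level
  \<open>k + 1\<close> into summand \<open>j\<close> at level \<open>k\<close>; summand 0 disappears
  because one of its factors in each product is constant.\<close>

lemma skew_bulk: "skew (Suc k) (Suc a) (Suc c) =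
    skew (Suc k) a (Suc c) + skew (Suc k) (Suc a) c - skew (Suc k) a c + skew k (Suc a) (Suc c)"
proof -
  let ?g = "\<lambda>k a c j. multichoose a (2 * k - 1 - j) * multichoose c j
                     - multichoose a j * multichoose c (2 * k - 1 - j)"
  let ?d = "\<lambda>j. ?g (Suc k) (Suc a) (Suc c) j - ?g (Suc k) a (Suc c) j - ?g (Suc k) (Suc a) c j
      + ?g (Suc k) a c j"
  have s: "?d (Suc j) = ?g k (Suc a) (Suc c) j" if "j < k" for j
  proof -
    define i where "i = 2 * k - 1 - j"
    have "2 * Suc k - 1 - j = Suc (Suc i)" "2 * k - j = Suc i" using that by (auto simp: i_def)
    then have "2 * Suc k - 1 - Suc j = Suc i" "2 * k - 1 - j = i" using that by (auto simp: i_def)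
    then show ?thesis by (simp add: algebra_simps)
  qed
  have "(\<Sum>j<Suc k. ?d j) = ?d 0 + (\<Sum>j<k. ?d (Suc j))" by (rule sum.lessThan_Suc_shift)
  also have "(\<Sum>j<k. ?d (Suc j)) = skew k (Suc a) (Suc c)"
    unfolding skew_def using s by (intro sum.cong refl) auto
  also have "?d 0 = 0" by simp
  finally have "(\<Sum>j<Suc k. ?d j) = skew k (Suc a) (Suc c)" by simp
  moreover have "(\<Sum>j<Suc k. ?d j) = skew (Suc k) (Suc a) (Suc c) - skew (Suc k) a (Suc c) - skew
      (Suc k) (Suc a) c + skew (Suc k) a c"
    unfolding skew_def[of "Suc k"] by (simp only: sum.distrib sum_subtractf)
  ultimately show ?thesis by simp
qed

text \<open>Writing the coefficients for \<open>a\<close> as differences of those for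
  \<open>Suc a\<close> makes the sum telescope; only the middle product survives.\<close>

lemma skew_below_diag: "skew (Suc k) (Suc a) a = (multichoose (Suc a) k)\<^sup>2"
proof -
  let ?E = "multichoose (Suc a)"
  let ?f = "\<lambda>j. if j = 0 then 0 else ?E (2 * k + 1 - j) * ?E (j - 1)"
  have "skew (Suc k) (Suc a) a = (\<Sum>j<Suc k. ?f (Suc j) - ?f j)"
    unfolding skew_def
  proof (intro sum.cong refl)
    fix j assume "j \<in> {..<Suc k}"
    then have j: "j \<le> k" by simp
    have E: "multichoose a i = ?E i - (if i = 0 then 0 else ?E (i - 1))" for i by (cases i) auto
    show "?E (2 * Suc k - 1 - j) * multichoose a j - ?E j * multichoose a (2 * Suc k - 1 - j)
        = ?f (Suc j) - ?f j"
      unfolding E using j by (auto simp: algebra_simps)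
  qed
  also have "\<dots> = ?f (Suc k) - ?f 0" by (rule sum_lessThan_telescope)
  finally show ?thesis by (simp add: power2_eq_square)
qed

text \<open>An instance of \<open>skew_bulk\<close> in which the diagonal value vanishes by
  antisymmetry.\<close>

lemma skew_two_below_diag: "skew (Suc k) (Suc (Suc a)) a =
    skew (Suc k) (Suc (Suc a)) (Suc a) + skew (Suc k) (Suc a) a - skew k (Suc (Suc a)) (Suc a)"
  using skew_bulk[of k "Suc a" a] by simp

text \<open>The last argument is shifted: the value at \<open>c\<close> is \<open>X\<^sub>k(a, c + 1)\<close>. After this shift the first
  summand is antisymmetric.\<close>

definition increment_formula :: "nat \<Rightarrow> nat \<Rightarrow> nat \<Rightarrow> int" where
  "increment_formula k a c = (if k = 0 then 0 else skew k a c +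
     multichoose c k * (multichoose a (k - 1) + multichoose (Suc a) (k - 1)))"

lemma increment_formula_bulk: "increment_formula (Suc k) (Suc a) (Suc c) =
    increment_formula (Suc k) a (Suc c) + increment_formula (Suc k) (Suc a) c - increment_formula
        (Suc k) a c + increment_formula k (Suc a) (Suc c)"
  by (cases k) (auto simp: increment_formula_def skew_bulk[of _ a c] algebra_simps)

lemmas multichoose_step = multichoose.simps(3)
declare multichoose_step [simp del]

lemma increment_formula_diag: "increment_formula (Suc k) (Suc a) a = (multichoose (Suc a) k)\<^sup>2 +
    multichoose a (Suc k) * (multichoose (Suc a) k + multichoose (Suc (Suc a)) k)"
  by (simp add: increment_formula_def skew_below_diag)

text \<open>The counterpart of \<open>increment_diag\<close>, with the claimed product in place of
  \<open>pair_count k (Suc a) (Suc a)\<close>. Once the values of \<open>skew\<close> are squares,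
  it is an identity between multiset coefficients.\<close>

lemma increment_formula_diag_step: "increment_formula (Suc k) (Suc (Suc a)) (Suc a) =
    increment_formula k (Suc (Suc a)) (Suc a) + increment_formula (Suc k) (Suc (Suc a)) a
        + multichoose (Suc a) k * multichoose (Suc (Suc a)) k"
proof (cases k)
  case 0
  have "skew (Suc 0) (Suc (Suc a)) a = 2"
    using skew_two_below_diag[of 0 a] skew_below_diag[of 0] by simp
  then show ?thesis
    by (simp add: 0 increment_formula_def skew_below_diag multichoose_step[of a 0])
next
  case (Suc l)
  let ?E = multichoose
  have "increment_formula (Suc k) (Suc (Suc a)) a = (?E (Suc (Suc a)) k)\<^sup>2
      + (?E (Suc a) k)\<^sup>2 - (?E (Suc (Suc a)) l)\<^sup>2
      + ?E a (Suc k) * (?E (Suc (Suc a)) k + ?E (Suc (Suc (Suc a))) k)"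
    using skew_two_below_diag[of k a] Suc by (simp add: increment_formula_def skew_below_diag)
  moreover have "increment_formula k (Suc (Suc a)) (Suc a) = (?E (Suc (Suc a)) l)\<^sup>2 +
      ?E (Suc a) k * (?E (Suc (Suc a)) l + ?E (Suc (Suc (Suc a))) l)"
    using increment_formula_diag[of l "Suc a"] Suc by simp
  moreover have "?E (Suc (Suc (Suc a))) k = ?E (Suc (Suc a)) k + ?E (Suc (Suc (Suc a))) l"
    "?E (Suc (Suc a)) k = ?E (Suc a) k + ?E (Suc (Suc a)) l"
    "?E (Suc a) (Suc k) = ?E a (Suc k) + ?E (Suc a) k"
    using Suc by (simp_all add: multichoose_step)
  ultimately show ?thesis unfolding increment_formula_diag[of k "Suc a"]
    by (simp only:) (simp add: power2_eq_square algebra_simps)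
qed

text \<open>The two claims need each other: the diagonal increment for width \<open>Suc a\<close>
  uses the diagonal count for width \<open>a\<close>, and the next diagonal count is obtained by
  summing diagonal increments over \<open>k\<close>.\<close>

lemma pair_count_solution:
  "(\<forall>k. pair_count k a a = multichoose a k * multichoose (Suc a) k) \<and>
   (\<forall>k. \<forall>c<a. increment k a (Suc c) = increment_formula k a c)"
proof (induction a)
  case 0
  have "pair_count k 0 0 = multichoose 0 k * multichoose (Suc 0) k" for k
    by (cases k) (auto simp: pair_count_no_columns)
  then show ?case by simp
next
  case (Suc a)
  have N: "pair_count k a a = multichoose a k * multichoose (Suc a) k"
    and XF: "c < a \<Longrightarrow> increment k a (Suc c) = increment_formula k a c" for k c using Suc by auto
  \<comment> \<open>Off the diagonal, formula and increment share the recurrence and the first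
    column; the induction runs over the column and, inside, over \<open>k\<close>.\<close>
  have X: "c < a \<Longrightarrow> increment k (Suc a) (Suc c) = increment_formula k (Suc a) c" for k c
  proof (induction c arbitrary: k)
    case 0
    show ?case by (cases k) (auto simp: increment_0 increment_one increment_formula_def
        skew_no_columns)
  next
    case (Suc c)
    then obtain a' where a': "a = Suc a'" by (cases a) auto
    have le: "Suc (Suc c) \<le> Suc a'" using Suc.prems a' by simp
    have IH: "increment k (Suc a) (Suc c) = increment_formula k (Suc a) c" for k using Suc by simp
    show ?case
    proof (induction k)
      case 0
      then show ?case by (simp add: increment_0 increment_formula_def)
    next
      case (Suc k)
      have "increment (Suc k) (Suc a) (Suc (Suc c)) = increment (Suc k) a (Suc (Suc c))
          + increment (Suc k) (Suc a) (Suc c)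
          - increment (Suc k) a (Suc c) + increment k (Suc a) (Suc (Suc c))"
        unfolding a' by (rule increment_bulk[OF le])
      also have "\<dots> = increment_formula (Suc k) (Suc a) (Suc c)"
        using \<open>Suc c < a\<close> by (simp add: IH XF Suc increment_formula_bulk[of k a c])
      finally show ?case .
    qed
  qed
  have D: "increment k (Suc a) (Suc a) = increment_formula k (Suc a) a" for k
  proof (cases a)
    case 0
    then show ?thesis by (cases k) (auto simp: increment_0 increment_one increment_formula_def
        skew_no_columns)
  next
    case a': (Suc a')
    show ?thesis
    proof (induction k)
      case 0
      then show ?case by (simp add: increment_0 increment_formula_def)
    next
      case (Suc k)
      then show ?case
        using increment_diag[of k a'] X[of a'] N[of k] increment_formula_diag_step[of k a']
            by (simp add: a')
    qed
  qed
  have "pair_count k (Suc a) (Suc a) = multichoose (Suc a) k * multichoose (Suc (Suc a)) k" for k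
  proof (induction k)
    case (Suc k)
    have "pair_count (Suc k) (Suc a) (Suc a) = pair_count (Suc k) a a
        + pair_count k (Suc a) (Suc a) + increment_formula (Suc k) (Suc a) a"
      using D[of "Suc k"] by (simp add: increment_def)
    then show ?case
      by (simp add: Suc N increment_formula_diag multichoose_step[of "Suc a" k]
          multichoose_step[of a k] power2_eq_square algebra_simps)
  qed simp
  then show ?case using X D by (auto simp: less_Suc_eq)
qed

subsection \<open>NW-paths with one turn\<close>

text \<open>For a fixed starting cell, \<open>walk\<close> is inverse to \<open>steps\<close>;
  questions about paths become questions about words of steps.\<close>

fun walk :: "cell \<Rightarrow> (int \<times> int) list \<Rightarrow> cell list" where
  "walk a [] = [a]"
| "walk a (s # ss) = a # walk (fst a + fst s, snd a + snd s) ss"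

lemma walk_nonempty [simp]: "walk a ss \<noteq> []"
  by (cases ss) auto

lemma hd_walk [simp]: "hd (walk a ss) = a"
  by (cases ss) auto

lemma hd_in_walk: "a \<in> set (walk a ss)"
  by (cases ss) auto

lemma last_in_walk: "last (walk a ss) \<in> set (walk a ss)"
  by simp

lemma steps_single [simp]: "steps [a] = []"
  by (simp add: steps_def)

lemma steps_Cons: "p \<noteq> [] \<Longrightarrow> steps (a # p) = (fst (hd p) - fst a, snd (hd p) - snd a) # steps p"
  by (cases p) (auto simp: steps_def)

lemma steps_walk [simp]: "steps (walk a ss) = ss"
  by (induction ss arbitrary: a) (auto simp: steps_Cons)

lemma walk_steps: "p \<noteq> [] \<Longrightarrow> walk (hd p) (steps p) = p"
proof (induction p)
  case (Cons a p)
  then show ?case by (cases "p = []") (auto simp: steps_Cons)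
qed simp

lemma walk_append: "walk a (ss @ ts) = walk a ss @ tl (walk (last (walk a ss)) ts)"
proof (induction ss arbitrary: a)
  case Nil
  then show ?case by (cases ts) auto
qed auto

lemma last_walk_append: "last (walk a (ss @ ts)) = last (walk (last (walk a ss)) ts)"
  by (induction ss arbitrary: a) auto

lemma set_walk_append:
  "set (walk a (ss @ ts)) = set (walk a ss) \<union> set (walk (last (walk a ss)) ts)"
proof -
  have "set (walk b ts) = insert b (set (tl (walk b ts)))" for b by (cases ts) auto
  then show ?thesis using last_in_walk[of a ss] by (auto simp: walk_append)
qed

lemma last_walk_north: "last (walk a (replicate k north)) = (fst a, snd a + int k)"
  by (induction k arbitrary: a) (auto simp: north_def)

lemma last_walk_west: "last (walk a (replicate k west)) = (fst a - int k, snd a)"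
  by (induction k arbitrary: a) (auto simp: west_def)

lemma in_walk_north: "c \<in> set (walk a (replicate k north)) \<Longrightarrow> fst c = fst a \<and> snd c \<in> {snd a..snd a
    + int k}"
  by (induction k arbitrary: a) (fastforce simp: north_def)+

lemma in_walk_west: "c \<in> set (walk a (replicate k west)) \<Longrightarrow> snd c = snd a \<and> fst c
    \<in> {fst a - int k..fst a}"
  by (induction k arbitrary: a) (fastforce simp: west_def)+

lemma NW_walk_monotone:
  "set ss \<subseteq> {north, west} \<Longrightarrow>
     fst (last (walk a ss)) \<le> fst a \<and> snd a \<le> snd (last (walk a ss))"
proof (induction ss arbitrary: a)
  case (Cons s ss)
  let ?b = "(fst a + fst s, snd a + snd s)"
  have "fst (last (walk ?b ss)) \<le> fst ?b \<and> snd ?b \<le> snd (last (walk ?b ss))"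
    using Cons.prems by (intro Cons.IH) auto
  then show ?case using Cons.prems by (auto simp: north_def west_def)
qed simp

section \<open>Turns in words of steps\<close>

definition turns :: "'a list \<Rightarrow> nat" where
  "turns ss = card {i. Suc i < length ss \<and> ss ! i \<noteq> ss ! Suc i}"

lemma direction_changes_turns: "direction_changes p = turns (steps p)"
  by (simp add: direction_changes_def turns_def)

lemma turns_Cons2: "turns (s # t # ss) = (if s = t then 0 else 1) + turns (t # ss)"
proof -
  let ?T = "{i. Suc i < length (t # ss) \<and> (t # ss) ! i \<noteq> (t # ss) ! Suc i}"
  have "{i. Suc i < length (s # t # ss) \<and> (s # t # ss) ! i \<noteq> (s # t # ss) ! Suc i}
      = (if s = t then {} else {0}) \<union> Suc ` ?T" (is "?S = _")
  proof (intro set_eqI)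
    fix i show "i \<in> ?S \<longleftrightarrow> i \<in> (if s = t then {} else {0}) \<union> Suc ` ?T" by (cases i) auto
  qed
  moreover have "finite ?T" by (rule finite_subset[of _ "{..<length (t # ss)}"]) auto
  ultimately show ?thesis
    by (auto simp: turns_def card_image card_insert_if)
qed

text \<open>Neighbouring letters can differ only at the junction, whose index is
  \<open>k - 1\<close>.\<close>

lemma turns_two_blocks: "turns (replicate k s @ replicate m t) \<le> 1"
proof -
  have "{i. Suc i < length (replicate k s @ replicate m t) \<and>
      (replicate k s @ replicate m t) ! i \<noteq> (replicate k s @ replicate m t) ! Suc i} \<subseteq> {k - 1}"
    by (auto simp: nth_append split: if_splits)
  from card_mono[OF _ this] show ?thesis by (simp add: turns_def)
qed

lemma turns_eq_0: "turns (s # ss) = 0 \<Longrightarrow> ss = replicate (length ss) s"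
proof (induction ss arbitrary: s)
  case (Cons t ss)
  then show ?case by (auto simp: turns_Cons2 split: if_splits)
qed simp

lemma turns_le_1:
  assumes "turns ss \<le> 1" "set ss \<subseteq> {s, t}" "s \<noteq> t"
  shows "\<exists>k m. ss = replicate k s @ replicate m t \<or> ss = replicate m t @ replicate k s"
  using assms
proof (induction ss)
  case Nil
  then show ?case by (intro exI[of _ 0]) simp
next
  case (Cons a ss)
  show ?case
  proof (cases ss)
    case Nil
    then show ?thesis using Cons.prems
      by (auto intro: exI[of _ 0] exI[of _ "Suc 0"] simp: exI[of _ "Suc 0"])
  next
    case b: (Cons b ss')
    show ?thesis
    proof (cases "a = b")
      case True
      then have "turns ss \<le> 1" using Cons.prems b by (simp add: turns_Cons2)
      then obtain k m where "ss = replicate k s @ replicate m t \<or> ss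
          = replicate m t @ replicate k s"
        using Cons by auto
      then show ?thesis
      proof
        assume ss: "ss = replicate k s @ replicate m t"
        show ?thesis
        proof (cases "a = s")
          case True
          then have "a # ss = replicate (Suc k) s @ replicate m t" using ss by simp
          then show ?thesis by blast
        next
          case False
          then have "k = 0" "a = t" using ss b \<open>a = b\<close> Cons.prems by (cases k; auto)+
          then have "a # ss = replicate 0 s @ replicate (Suc m) t" using ss by simp
          then show ?thesis by blast
        qed
      next
        assume ss: "ss = replicate m t @ replicate k s"
        show ?thesis
        proof (cases "a = t")
          case True
          then have "a # ss = replicate (Suc m) t @ replicate k s" using ss by simp
          then show ?thesis by blast
        next
          case False
          then have "m = 0" "a = s" using ss b \<open>a = b\<close> Cons.prems by (cases m; auto)+
          then have "a # ss = replicate 0 t @ replicate (Suc k) s" using ss by simp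
          then show ?thesis by blast
        qed
      qed
    next
      case False
      \<comment> \<open>The first two letters already make a turn, so the rest is constant.\<close>
      then have "turns (b # ss') = 0" using Cons.prems b by (simp add: turns_Cons2)
      then have "ss = replicate (Suc (length ss')) b" using turns_eq_0[of b ss'] b by simp
      then have "a # ss = replicate 1 a @ replicate (Suc (length ss')) b" by simp
      moreover have "a = s \<and> b = t \<or> a = t \<and> b = s" using False Cons.prems b by auto
      ultimately show ?thesis by blast
    qed
  qed
qed

lemma NW_path_between_walk:
  "NW_path_between P a b p \<longleftrightarrow>
     (\<exists>ss. p = walk a ss \<and> last p = b \<and> set p \<subseteq> P \<and> set ss \<subseteq> {north, west})"
proof
  assume "NW_path_between P a b p"
  then show "\<exists>ss. p = walk a ss \<and> last p = b \<and> set p \<subseteq> P \<and> set ss \<subseteq> {north, west}"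
    using walk_steps[of p] by (intro exI[of _ "steps p"]) (auto simp: NW_path_between_def
        NW_path_def)
qed (auto simp: NW_path_between_def NW_path_def)

lemma NW_reachesD:
  assumes "NW_reaches P a b"
  shows "a \<in> P" "b \<in> P" "fst b \<le> fst a" "snd a \<le> snd b"
proof -
  obtain ss where "last (walk a ss) = b" "set (walk a ss) \<subseteq> P" "set ss \<subseteq> {north, west}"
    using assms by (auto simp: NW_reaches_def NW_path_between_walk)
  then show "a \<in> P" "b \<in> P" "fst b \<le> fst a" "snd a \<le> snd b"
    using hd_in_walk[of a ss] last_in_walk[of a ss] NW_walk_monotone[of ss a] by auto
qed

text \<open>A path with at most one turn consists of two straight blocks, and the cell where they
  meet is a corner of the rectangle spanned by \<open>a\<close> and \<open>b\<close>.\<close>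

lemma NW_path_one_turn_corner:
  assumes "NW_path_between P a b p" "direction_changes p \<le> 1"
  shows "(fst b, snd a) \<in> P \<or> (fst a, snd b) \<in> P"
proof -
  obtain ss where ss: "p = walk a ss" "last (walk a ss) = b" "set (walk a ss) \<subseteq> P" "set ss \<subseteq>
      {north, west}"
    using assms by (auto simp: NW_path_between_walk)
  have "north \<noteq> west" by (simp add: north_def west_def)
  then obtain k m where
    "ss = replicate k north @ replicate m west \<or> ss = replicate m west @ replicate k north"
    using turns_le_1[of ss north west] assms(2) ss by (auto simp: direction_changes_turns)
  then show ?thesis
  proof
    assume e: "ss = replicate k north @ replicate m west"
    then have "last (walk a (replicate k north)) \<in> P"
      using ss last_in_walk[of a "replicate k north"] unfolding e set_walk_append by blast
    then show ?thesis
      using ss(2) by (auto simp: e last_walk_append last_walk_north last_walk_west)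
  next
    assume e: "ss = replicate m west @ replicate k north"
    then have "last (walk a (replicate m west)) \<in> P"
      using ss last_in_walk[of a "replicate m west"] unfolding e set_walk_append by blast
    then show ?thesis
      using ss(2) by (auto simp: e last_walk_append last_walk_north last_walk_west)
  qed
qed

lemma NW_path_north_west:
  assumes "x' \<le> x" "y \<le> y'" "\<And>z. z \<in> {y..y'} \<Longrightarrow> (x, z) \<in> P" "\<And>z. z \<in> {x'..x} \<Longrightarrow> (z, y') \<in> P"
  shows "\<exists>p. NW_path_between P (x, y) (x', y') p \<and> direction_changes p \<le> 1"
proof (intro exI conjI)
  let ?ss = "replicate (nat (y' - y)) north @ replicate (nat (x - x')) west"
  have "set (walk (x, y) ?ss) \<subseteq> P"
    using assms by (auto simp: set_walk_append last_walk_north dest!: in_walk_north in_walk_west)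
  then show "NW_path_between P (x, y) (x', y') (walk (x, y) ?ss)"
    using assms(1,2)
    by (auto simp: NW_path_between_def NW_path_def last_walk_append last_walk_north last_walk_west)
  show "direction_changes (walk (x, y) ?ss) \<le> 1"
    unfolding direction_changes_turns steps_walk by (rule turns_two_blocks)
qed

lemma NW_path_west_north:
  assumes "x' \<le> x" "y \<le> y'" "\<And>z. z \<in> {x'..x} \<Longrightarrow> (z, y) \<in> P" "\<And>z. z \<in> {y..y'} \<Longrightarrow> (x', z) \<in> P"
  shows "\<exists>p. NW_path_between P (x, y) (x', y') p \<and> direction_changes p \<le> 1"
proof (intro exI conjI)
  let ?ss = "replicate (nat (x - x')) west @ replicate (nat (y' - y)) north"
  have "set (walk (x, y) ?ss) \<subseteq> P"
    using assms by (auto simp: set_walk_append last_walk_west dest!: in_walk_north in_walk_west)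
  then show "NW_path_between P (x, y) (x', y') (walk (x, y) ?ss)"
    using assms(1,2)
    by (auto simp: NW_path_between_def NW_path_def last_walk_append last_walk_north last_walk_west)
  show "direction_changes (walk (x, y) ?ss) \<le> 1"
    unfolding direction_changes_turns steps_walk by (rule turns_two_blocks)
qed

lemma NW_reaches_trans:
  assumes "NW_reaches P a b" "NW_reaches P b c"
  shows "NW_reaches P a c"
proof -
  obtain ss ts where "last (walk a ss) = b" "set (walk a ss) \<subseteq> P" "set ss \<subseteq> {north, west}"
    "last (walk b ts) = c" "set (walk b ts) \<subseteq> P" "set ts \<subseteq> {north, west}"
    using assms by (auto simp: NW_reaches_def NW_path_between_walk)
  then have "NW_path_between P a c (walk a (ss @ ts))"
    by (auto simp: NW_path_between_def NW_path_def last_walk_append set_walk_append)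
  then show ?thesis by (auto simp: NW_reaches_def)
qed

lemma D_NW_between_le_1:
  assumes "NW_reaches P a b"
  shows "D_NW_between P a b \<le> 1 \<longleftrightarrow> (\<exists>p. NW_path_between P a b p \<and> direction_changes p \<le> 1)"
proof
  assume "D_NW_between P a b \<le> 1"
  moreover have "\<exists>p. NW_path_between P a b p \<and> direction_changes p = D_NW_between P a b"
    unfolding D_NW_between_def
    by (rule LeastI_ex) (use assms in \<open>auto simp: NW_reaches_def\<close>)
  ultimately show "\<exists>p. NW_path_between P a b p \<and> direction_changes p \<le> 1" by metis
next
  assume "\<exists>p. NW_path_between P a b p \<and> direction_changes p \<le> 1"
  then obtain p where p: "NW_path_between P a b p" "direction_changes p \<le> 1" by blast
  have "D_NW_between P a b \<le> direction_changes p"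
    unfolding D_NW_between_def by (rule Least_le) (use p in blast)
  with p show "D_NW_between P a b \<le> 1" by simp
qed

lemma D_NW_le_1:
  assumes "finite P" "P \<noteq> {}"
  shows "D_NW P \<le> 1 \<longleftrightarrow> (\<forall>a b. NW_reaches P a b \<longrightarrow> (\<exists>p. NW_path_between P a b p
      \<and> direction_changes p \<le> 1))"
proof -
  let ?D = "{D_NW_between P a b | a b. NW_reaches P a b}"
  have "?D \<subseteq> (\<lambda>(a, b). D_NW_between P a b) ` (P \<times> P)"
    using NW_reachesD by fastforce
  then have fin: "finite ?D" using assms(1) by (meson finite_SigmaI finite_imageI finite_subset)
  obtain a where "a \<in> P" using assms(2) by blast
  \<comment> \<open>The one-cell path shows that the maximum is taken over a non-empty set.\<close>
  then have "NW_reaches P a a"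
    by (auto simp: NW_reaches_def NW_path_between_walk intro!: exI[of _ "[]"])
  then have "?D \<noteq> {}" by blast
  then have "D_NW P \<le> 1 \<longleftrightarrow> (\<forall>d\<in>?D. d \<le> 1)" unfolding D_NW_def using fin by simp
  then show ?thesis using D_NW_between_le_1 by blast
qed

subsection \<open>Convex polyominoes with a full row\<close>

text \<open>Connectedness is left out because it follows: every cell is joined to row
  \<open>y0\<close> inside its column.\<close>

definition full_row :: "int \<Rightarrow> int \<Rightarrow> int \<Rightarrow> cell set \<Rightarrow> bool" where
  "full_row l r y0 P \<longleftrightarrow> finite P \<and> l \<le> r \<and> fst ` P \<subseteq> {l..r} \<and> (\<forall>x\<in>{l..r}. (x, y0) \<in> P) \<and>
     (\<forall>y. contiguous {x. (x, y) \<in> P}) \<and> (\<forall>x. contiguous {y. (x, y) \<in> P})"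

lemma contiguousD: "contiguous S \<Longrightarrow> i \<in> S \<Longrightarrow> k \<in> S \<Longrightarrow> i \<le> j \<Longrightarrow> j \<le> k \<Longrightarrow> j \<in> S"
  by (fastforce simp: contiguous_def)

lemma full_row_x: "full_row l r y0 P \<Longrightarrow> (x, y) \<in> P \<Longrightarrow> l \<le> x \<and> x \<le> r"
  by (force simp: full_row_def)

lemma full_row_base: "full_row l r y0 P \<Longrightarrow> (x, y) \<in> P \<Longrightarrow> (x, y0) \<in> P"
  by (force simp: full_row_def)

lemma full_row_column:
  "full_row l r y0 P \<Longrightarrow> (x, y) \<in> P \<Longrightarrow> (x, y') \<in> P \<Longrightarrow> y \<le> z \<Longrightarrow> z \<le> y' \<Longrightarrow> (x, z) \<in> P"
  using contiguousD[of "{y. (x, y) \<in> P}" y y' z] by (simp add: full_row_def)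

lemma full_row_row:
  "full_row l r y0 P \<Longrightarrow> (x, y) \<in> P \<Longrightarrow> (x', y) \<in> P \<Longrightarrow> x \<le> z \<Longrightarrow> z \<le> x' \<Longrightarrow> (z, y) \<in> P"
  using contiguousD[of "{x. (x, y) \<in> P}" x x' z] by (simp add: full_row_def)

lemma full_row_convex_polyomino:
  assumes P: "full_row l r y0 P"
  shows "convex_polyomino P"
proof -
  let ?R = "{(c, d). c \<in> P \<and> d \<in> P \<and> share_edge c d}"
  have "sym ?R" by (auto simp: sym_def share_edge_def)
  then have symR: "(a, b) \<in> ?R\<^sup>* \<Longrightarrow> (b, a) \<in> ?R\<^sup>*" for a b
    by (meson sym_rtrancl symE)
  have vert: "((x, y), (x, y0)) \<in> ?R\<^sup>*" if "(x, y) \<in> P" for x y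
    using that
  proof (induction "nat \<bar>y - y0\<bar>" arbitrary: y)
    case 0
    then show ?case by simp
  next
    case (Suc k)
    define y' where "y' = (if y < y0 then y + 1 else y - 1)"
    have "(x, y') \<in> P"
      using full_row_column[OF P, of x y y0 y'] full_row_column[OF P, of x y0 y y']
        full_row_base[OF P Suc.prems] Suc.prems Suc.hyps(2) by (auto simp: y'_def)
    moreover have "k = nat \<bar>y' - y0\<bar>" using Suc.hyps(2) by (auto simp: y'_def)
    ultimately have "((x, y'), (x, y0)) \<in> ?R\<^sup>*" using Suc.hyps(1) by blast
    moreover have "((x, y), (x, y')) \<in> ?R"
      using Suc.prems \<open>(x, y') \<in> P\<close> by (auto simp: share_edge_def y'_def)
    ultimately show ?case by (rule converse_rtrancl_into_rtrancl[rotated])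
  qed
  have horiz: "((x, y0), (l, y0)) \<in> ?R\<^sup>*" if "(x, y0) \<in> P" for x
    using that
  proof (induction "nat (x - l)" arbitrary: x)
    case 0
    then show ?case using full_row_x[OF P 0(2)] by simp
  next
    case (Suc k)
    have "(x - 1, y0) \<in> P"
      using full_row_x[OF P Suc.prems] Suc.hyps(2) P by (auto simp: full_row_def)
    moreover have "k = nat (x - 1 - l)" using Suc.hyps(2) by auto
    ultimately have "((x - 1, y0), (l, y0)) \<in> ?R\<^sup>*" using Suc.hyps(1) by blast
    moreover have "((x, y0), (x - 1, y0)) \<in> ?R"
      using Suc.prems \<open>(x - 1, y0) \<in> P\<close> by (auto simp: share_edge_def)
    ultimately show ?case by (rule converse_rtrancl_into_rtrancl[rotated])
  qed
  have base: "(a, (l, y0)) \<in> ?R\<^sup>*" if "a \<in> P" for a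
  proof -
    have "((fst a, snd a), (fst a, y0)) \<in> ?R\<^sup>*" using that by (intro vert) simp
    moreover have "((fst a, y0), (l, y0)) \<in> ?R\<^sup>*"
      using full_row_base[OF P, of "fst a" "snd a"] that by (intro horiz) simp
    ultimately show ?thesis by simp
  qed
  have "(a, b) \<in> ?R\<^sup>*" if "a \<in> P" "b \<in> P" for a b
    using base[OF that(1)] symR[OF base[OF that(2)]] by (rule rtrancl_trans)
  then have "edge_connected P" by (simp add: edge_connected_def)
  moreover have "(l, y0) \<in> P" using P by (simp add: full_row_def)
  ultimately show ?thesis
    using P by (auto simp: convex_polyomino_def polyomino_def full_row_def)
qed

text \<open>Only a cell below the full row and a cell above it can fail to be joined with one turn.\<close>

lemma full_row_ascending_iff:
  assumes P: "full_row l r y0 P"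
  shows "ascending P \<longleftrightarrow> (\<forall>x y x' y'. (x, y) \<in> P \<longrightarrow> (x', y') \<in> P \<longrightarrow> x' < x \<longrightarrow> y < y0 \<longrightarrow> y0 < y' \<longrightarrow>
     (x', y) \<in> P \<or> (x, y') \<in> P)" (is "_ \<longleftrightarrow> ?C")
proof -
  note col = full_row_column[OF P] and row = full_row_row[OF P] and base = full_row_base[OF P]
  have "finite P" "(l, y0) \<in> P" using P by (auto simp: full_row_def)
  then have "ascending P \<longleftrightarrow> (\<forall>a b. NW_reaches P a b \<longrightarrow> (\<exists>p. NW_path_between P a b p
      \<and> direction_changes p \<le> 1))"
    using full_row_convex_polyomino[OF P] D_NW_le_1[of P] by (auto simp: ascending_def)
  also have "\<dots> \<longleftrightarrow> ?C"
  proof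
    assume L: "\<forall>a b. NW_reaches P a b \<longrightarrow> (\<exists>p. NW_path_between P a b p \<and> direction_changes p \<le> 1)"
    show ?C
    proof (intro allI impI)
      fix x y x' y'
      assume *: "(x, y) \<in> P" "(x', y') \<in> P" "x' < x" "y < y0" "y0 < y'"
      \<comment> \<open>The two cells are always joined through row \<open>y0\<close>: north, west
        along that row, north. Being ascending then yields a path with one turn and hence a corner
        in \<open>P\<close>.\<close>
      have "NW_reaches P (x, y) (x', y0)"
        using NW_path_north_west[of x' x y y0 P] col[OF *(1) base[OF *(1)]] row[OF base[OF *(2)]
            base[OF *(1)]] *
        by (auto simp: NW_reaches_def)
      moreover have "NW_reaches P (x', y0) (x', y')"
        using NW_path_north_west[of x' x' y0 y' P] col[OF base[OF *(2)] *(2)] *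
        by (auto simp: NW_reaches_def)
      ultimately obtain p where "NW_path_between P (x, y) (x', y') p" "direction_changes p \<le> 1"
        using L NW_reaches_trans by blast
      then show "(x', y) \<in> P \<or> (x, y') \<in> P" using NW_path_one_turn_corner by fastforce
    qed
  next
    assume C: ?C
    show "\<forall>a b. NW_reaches P a b \<longrightarrow> (\<exists>p. NW_path_between P a b p \<and> direction_changes p \<le> 1)"
    proof (intro allI impI)
      fix a b assume ab: "NW_reaches P a b"
      obtain x y x' y' where [simp]: "a = (x, y)" "b = (x', y')" by (cases a; cases b)
      note * = NW_reachesD[OF ab, simplified]
      \<comment> \<open>One further corner of the rectangle suffices, since convexity fills the two
        sides meeting there. If both cells lie weakly on one side of row \<open>y0\<close>, a column
        down or up to that row contains the corner.\<close>
      have "(x', y) \<in> P \<or> (x, y') \<in> P"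
      proof -
        consider "y0 \<le> y" | "y' \<le> y0" | "y < y0" "y0 < y'" by linarith
        then show ?thesis
        proof cases
          case 1
          then show ?thesis using col[OF base[OF *(2)] *(2), of y] * by simp
        next
          case 2
          then show ?thesis using col[OF *(1) base[OF *(1)], of y'] * by simp
        next
          case 3
          then show ?thesis using C * by (cases "x = x'") auto
        qed
      qed
      then show "\<exists>p. NW_path_between P a b p \<and> direction_changes p \<le> 1"
      proof
        assume c: "(x', y) \<in> P"
        show ?thesis
          using NW_path_west_north[of x' x y y' P] row[OF c *(1)] col[OF c *(2)] * by auto
      next
        assume c: "(x, y') \<in> P"
        show ?thesis
          using NW_path_north_west[of x' x y y' P] row[OF *(2) c] col[OF *(1) c] * by auto
      qed
    qed
  qed
  finally show ?thesis .
qed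

lemma full_row_cols:
  assumes P: "full_row l r y0 P"
  shows "min_col P = l" "max_col P = r"
proof -
  have "l \<in> fst ` P" "r \<in> fst ` P" using P by (force simp: full_row_def)+
  then show "min_col P = l" "max_col P = r"
    using P unfolding min_col_def max_col_def
    by (auto intro!: Min_eqI Max_eqI simp: full_row_def)
qed

lemma full_row_centered: "full_row l r y0 P \<Longrightarrow> centered P"
  unfolding centered_def by (simp add: full_row_cols) (auto simp: full_row_def intro!: exI[of _ y0])

lemma centered_full_row:
  assumes "convex_polyomino P" "centered P"
  shows "\<exists>y0. full_row (min_col P) (max_col P) y0 P"
proof -
  obtain y0 where y0: "(min_col P, y0) \<in> P" "(max_col P, y0) \<in> P"
    using assms(2) by (auto simp: centered_def)
  have fin: "finite (fst ` P)" using assms(1) by (simp add: convex_polyomino_def polyomino_def)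
  have sub: "fst ` P \<subseteq> {min_col P..max_col P}"
    by (intro subsetI) (simp add: min_col_def max_col_def fin)
  have "min_col P \<in> {min_col P..max_col P}"
    by (rule subsetD[OF sub]) (use y0(1) in \<open>rule image_eqI[rotated]; simp\<close>)
  then have le: "min_col P \<le> max_col P" by simp
  have "contiguous {x. (x, y0) \<in> P}" using assms(1) by (simp add: convex_polyomino_def)
  then have "(x, y0) \<in> P" if "x \<in> {min_col P..max_col P}" for x
    using contiguousD[of "{x. (x, y0) \<in> P}" "min_col P" "max_col P" x] y0 that by simp
  then have "full_row (min_col P) (max_col P) y0 P"
    using assms(1) sub le unfolding full_row_def convex_polyomino_def polyomino_def by simp
  then show ?thesis ..
qed

section \<open>Interval lists as rows of cells\<close>

definition rows_of :: "(int \<times> int) list \<Rightarrow> nat \<Rightarrow> int set" where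
  "rows_of L k = (if k < length L then {fst (L ! k)..snd (L ! k)} else {})"

lemma rows_of_Nil [simp]: "rows_of [] k = {}"
  by (simp add: rows_of_def)

lemma rows_of_Cons: "rows_of (p # L) k = (case k of 0 \<Rightarrow> {fst p..snd p} | Suc m \<Rightarrow> rows_of L m)"
  by (simp add: rows_of_def split: nat.split)

lemma rows_of_antimono:
  assumes "nested_in i a L" "k \<le> m"
  shows "rows_of L m \<subseteq> rows_of L k"
proof (cases "k = m")
  case False
  then show ?thesis
    using assms by (auto simp: rows_of_def nested_in_def sorted_wrt_iff_nth_less inside_def)
qed simp

lemma rows_of_bounds: "nested_in i a L \<Longrightarrow> rows_of L k \<subseteq> {i..<a}"
  by (auto simp: rows_of_def nested_in_def dest!: nth_mem)

lemma rows_of_eq_empty: "nested_in i a L \<Longrightarrow> rows_of L k = {} \<longleftrightarrow> length L \<le> k"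
  by (auto simp: rows_of_def nested_in_def)

lemma contiguous_rows_of: "contiguous (rows_of L k)"
  by (auto simp: contiguous_def rows_of_def)

lemma rows_of_inj:
  assumes "nested_in i a L" "nested_in i' a' L'" "\<And>k. rows_of L k = rows_of L' k"
  shows "L = L'"
proof (rule nth_equalityI)
  have "length L \<le> k \<longleftrightarrow> length L' \<le> k" for k
    using rows_of_eq_empty[OF assms(1)] rows_of_eq_empty[OF assms(2)] assms(3) by metis
  then show len: "length L = length L'" by (meson order_antisym order_refl)
  fix k assume k: "k < length L"
  then have "fst (L ! k) \<le> snd (L ! k)" using assms(1) by (simp add: nested_in_def)
  moreover have "{fst (L ! k)..snd (L ! k)} = {fst (L' ! k)..snd (L' ! k)}"
    using assms(3)[of k] k len by (simp add: rows_of_def)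
  ultimately show "L ! k = L' ! k" by (simp add: Icc_eq_Icc prod_eq_iff)
qed

text \<open>Peel off \<open>S 0\<close>, an interval that contains all later sets. The empty set
  \<open>S m\<close> bounds the number of peelings.\<close>

lemma rows_of_exists:
  assumes "\<And>k. S (Suc k) \<subseteq> S k" "\<And>k. contiguous (S k)" "S 0 \<subseteq> {i..<a}" "S m = {}"
  shows "\<exists>L. nested_in i a L \<and> (\<forall>k. S k = rows_of L k)"
  using assms
proof (induction m arbitrary: S i a)
  case 0
  have "S k = {}" for k
    by (induction k) (use 0 in auto)
  then show ?case by (intro exI[of _ "[]"]) simp
next
  case (Suc m)
  show ?case
  proof (cases "S 0 = {}")
    case True
    have "S k = {}" for k
      by (induction k) (use True Suc.prems(1) in auto)
    then show ?thesis by (intro exI[of _ "[]"]) simp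
  next
    case False
    define l r where "l = Min (S 0)" and "r = Max (S 0)"
    have fin: "finite (S 0)" using Suc.prems(3) finite_subset by blast
    then have lr: "l \<in> S 0" "r \<in> S 0" using False by (simp_all add: l_def r_def)
    have S0: "S 0 = {l..r}"
    proof
      show "S 0 \<subseteq> {l..r}" using fin by (auto simp: l_def r_def)
      show "{l..r} \<subseteq> S 0" using Suc.prems(2)[of 0] lr by (simp add: contiguous_def)
    qed
    have "\<exists>L. nested_in l (r + 1) L \<and> (\<forall>k. S (Suc k) = rows_of L k)"
      by (rule Suc.IH) (use Suc.prems(1)[of 0] Suc.prems S0 in auto)
    then obtain L where L: "nested_in l (r + 1) L" "\<And>k. S (Suc k) = rows_of L k" by blast
    have "nested_in i a ((l, r) # L)"
      using L lr Suc.prems(3) S0 by (auto simp: nested_in_Cons)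
    moreover have "S k = rows_of ((l, r) # L) k" for k
      using L(2) S0 by (cases k) (auto simp: rows_of_Cons)
    ultimately show ?thesis by blast
  qed
qed

lemma compatible_rows_of:
  assumes I: "nested_in i a I" and J: "nested_in j b J"
  shows "compatible I J \<longleftrightarrow> (\<forall>k m x x'. x' \<in> rows_of I k \<longrightarrow> x \<in> rows_of J m \<longrightarrow> x' < x \<longrightarrow>
    x' \<in> rows_of J m \<or> x \<in> rows_of I k)" (is "_ \<longleftrightarrow> ?C")
proof
  assume c: "compatible I J"
  show ?C
  proof (intro allI impI)
    fix k m x x'
    assume *: "x' \<in> rows_of I k" "x \<in> rows_of J m" "x' < x"
    then have len: "k < length I" "m < length J" by (auto simp: rows_of_def split: if_splits)
    then have "fst (I ! k) < fst (J ! m) \<longrightarrow> snd (J ! m) \<le> snd (I ! k)"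
      using c by (simp add: compatible_def)
    then show "x' \<in> rows_of J m \<or> x \<in> rows_of I k" using * len by (auto simp: rows_of_def)
  qed
next
  assume C: ?C
  show "compatible I J" unfolding compatible_def
  proof (intro ballI impI)
    fix p q assume pq: "p \<in> set I" "q \<in> set J" "fst p < fst q"
    then obtain k m where km: "k < length I" "p = I ! k" "m < length J" "q = J ! m"
      by (auto simp: in_set_conv_nth)
    have "fst p \<le> snd p" "fst q \<le> snd q" using I J pq by (auto simp: nested_in_def)
    \<comment> \<open>The test cells are the left end of \<open>p\<close> and the right end of
      \<open>q\<close>.\<close>
    then show "snd q \<le> snd p"
      using C[rule_format, of "fst p" k "snd q" m] km pq by (auto simp: rows_of_def)
  qed
qed

text \<open>Row 0 is the full row; entry \<open>k\<close> of \<open>I\<close> is row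
  \<open>k + 1\<close> and entry \<open>k\<close> of \<open>J\<close> is row
  \<open>- k - 1\<close>.\<close>

definition stack_polyomino :: "int \<Rightarrow> (int \<times> int) list \<Rightarrow> (int \<times> int) list \<Rightarrow> cell set" where
  "stack_polyomino w I J = {(x, y). y = 0 \<and> 0 \<le> x \<and> x < w \<or>
     y > 0 \<and> x \<in> rows_of I (nat (y - 1)) \<or> y < 0 \<and> x \<in> rows_of J (nat (- y - 1))}"

lemma full_row_stack_polyomino:
  assumes I: "nested_in 0 w I" and J: "nested_in 0 w J" and w: "1 \<le> w"
  shows "full_row 0 (w - 1) 0 (stack_polyomino w I J)"
proof -
  let ?P = "stack_polyomino w I J"
  have x: "0 \<le> x \<and> x < w" if "(x, y) \<in> ?P" for x y
    using that rows_of_bounds[OF I, of "nat (y - 1)"] rows_of_bounds[OF J, of "nat (- y - 1)"]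
    by (auto simp: stack_polyomino_def)
  have y: "- int (length J) \<le> y \<and> y \<le> int (length I)" if "(x, y) \<in> ?P" for x y
    using that by (auto simp: stack_polyomino_def rows_of_def split: if_splits)
  have "?P \<subseteq> {0..<w} \<times> {- int (length J)..int (length I)}" using x y by auto
  then have fin: "finite ?P" by (rule finite_subset) simp
  have row: "contiguous {x. (x, y) \<in> ?P}" for y
  proof (cases "y = 0")
    case True
    then show ?thesis by (auto simp: stack_polyomino_def contiguous_def)
  next
    case False
    then have "{x. (x, y) \<in> ?P} = (if y > 0 then rows_of I (nat (y - 1)) else rows_of J (nat (- y
        - 1)))"
      by (auto simp: stack_polyomino_def)
    then show ?thesis by (simp add: contiguous_rows_of)
  qed
  have col: "contiguous {y. (x, y) \<in> ?P}" for x
    unfolding contiguous_def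
  proof (intro ballI subsetI)
    fix y y' z assume *: "y \<in> {y. (x, y) \<in> ?P}" "y' \<in> {y. (x, y) \<in> ?P}" "z \<in> {y..y'}"
    have b: "0 \<le> x \<and> x < w" using x *(1) by simp
    \<comment> \<open>Row 0 contains every column in use; any other row contains all rows beyond it
      on the same side, by nestedness.\<close>
    consider "z = 0" | "z > 0" | "z < 0" by linarith
    then show "z \<in> {y. (x, y) \<in> ?P}"
    proof cases
      case 1
      then show ?thesis using b by (simp add: stack_polyomino_def)
    next
      case 2
      then have "rows_of I (nat (y' - 1)) \<subseteq> rows_of I (nat (z - 1))"
        using *(3) by (intro rows_of_antimono[OF I]) auto
      then show ?thesis using 2 * by (auto simp: stack_polyomino_def)
    next
      case 3
      then have "rows_of J (nat (- y - 1)) \<subseteq> rows_of J (nat (- z - 1))"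
        using *(3) by (intro rows_of_antimono[OF J]) auto
      then show ?thesis using 3 * by (auto simp: stack_polyomino_def)
    qed
  qed
  show ?thesis
    unfolding full_row_def
  proof (intro conjI allI)
    show "fst ` ?P \<subseteq> {0..w - 1}" using x by auto
    show "\<forall>x\<in>{0..w - 1}. (x, 0) \<in> ?P" by (simp add: stack_polyomino_def)
  qed (use fin w row col in simp_all)
qed

lemma ascending_stack_polyomino:
  assumes I: "nested_in 0 w I" and J: "nested_in 0 w J" and w: "1 \<le> w"
  shows "ascending (stack_polyomino w I J) \<longleftrightarrow> compatible I J"
proof -
  let ?P = "stack_polyomino w I J"
  have up: "(x, y) \<in> ?P \<longleftrightarrow> x \<in> rows_of I (nat (y - 1))" if "0 < y" for x y
    using that by (auto simp: stack_polyomino_def)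
  have down: "(x, y) \<in> ?P \<longleftrightarrow> x \<in> rows_of J (nat (- y - 1))" if "y < 0" for x y
    using that by (auto simp: stack_polyomino_def)
  have "ascending ?P \<longleftrightarrow> (\<forall>x y x' y'. (x, y) \<in> ?P \<longrightarrow> (x', y') \<in> ?P \<longrightarrow> x' < x \<longrightarrow> y < 0 \<longrightarrow> 0 < y' \<longrightarrow>
     (x', y) \<in> ?P \<or> (x, y') \<in> ?P)"
    by (rule full_row_ascending_iff[OF full_row_stack_polyomino[OF assms]])
  also have "\<dots> \<longleftrightarrow> (\<forall>k m x x'. x' \<in> rows_of I k \<longrightarrow> x \<in> rows_of J m \<longrightarrow> x' < x \<longrightarrow>
    x' \<in> rows_of J m \<or> x \<in> rows_of I k)"
  proof (intro iffI allI impI)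
    fix k m x x'
    assume L: "\<forall>x y x' y'. (x, y) \<in> ?P \<longrightarrow> (x', y') \<in> ?P \<longrightarrow> x' < x \<longrightarrow> y < 0 \<longrightarrow> 0 < y' \<longrightarrow>
       (x', y) \<in> ?P \<or> (x, y') \<in> ?P"
      and "x' \<in> rows_of I k" "x \<in> rows_of J m" "x' < x"
    then show "x' \<in> rows_of J m \<or> x \<in> rows_of I k"
      using L[rule_format, of x "- int m - 1" x' "int k + 1"] by (simp add: up down)
  next
    fix x y x' y'
    assume "\<forall>k m x x'. x' \<in> rows_of I k \<longrightarrow> x \<in> rows_of J m \<longrightarrow> x' < x \<longrightarrow>
        x' \<in> rows_of J m \<or> x \<in> rows_of I k"
      "(x, y) \<in> ?P" "(x', y') \<in> ?P" "x' < x" "y < 0" "0 < y'"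
    then show "(x', y) \<in> ?P \<or> (x, y') \<in> ?P" by (simp add: up down)
  qed
  also have "\<dots> \<longleftrightarrow> compatible I J" using compatible_rows_of[OF I J] by blast
  finally show ?thesis .
qed

lemma semi_perimeter_stack_polyomino:
  assumes I: "nested_in 0 w I" and J: "nested_in 0 w J" and w: "1 \<le> w"
  shows "semi_perimeter (stack_polyomino w I J) = nat w + length I + length J + 1"
proof -
  let ?P = "stack_polyomino w I J"
  note P = full_row_stack_polyomino[OF assms]
  have fin: "finite (snd ` ?P)" using P by (simp add: full_row_def)
  have y: "- int (length J) \<le> y \<and> y \<le> int (length I)" if "y \<in> snd ` ?P" for y
    using that by (auto simp: stack_polyomino_def rows_of_def split: if_splits)
  have top: "int (length I) \<in> snd ` ?P"
  proof (cases "I = []")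
    case True
    then show ?thesis using w by (force simp: stack_polyomino_def)
  next
    case False
    then have "rows_of I (length I - 1) \<noteq> {}"
      using rows_of_eq_empty[OF I, of "length I - 1"] by (cases I) auto
    then obtain x where "x \<in> rows_of I (length I - 1)" by blast
    then have "(x, int (length I)) \<in> ?P" using False by (cases I) (auto simp: stack_polyomino_def)
    then show ?thesis by force
  qed
  have bottom: "- int (length J) \<in> snd ` ?P"
  proof (cases "J = []")
    case True
    then show ?thesis using w by (force simp: stack_polyomino_def)
  next
    case False
    then have "rows_of J (length J - 1) \<noteq> {}"
      using rows_of_eq_empty[OF J, of "length J - 1"] by (cases J) auto
    then obtain x where "x \<in> rows_of J (length J - 1)" by blast
    then have "(x, - int (length J)) \<in> ?P" using False by (cases J) (auto simp: stack_polyomino_def)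
    then show ?thesis by force
  qed
  have "max_row ?P = int (length I)" unfolding max_row_def
    by (rule Max_eqI) (use fin y top in blast)+
  moreover have "min_row ?P = - int (length J)" unfolding min_row_def
    by (rule Min_eqI) (use fin y bottom in blast)+
  ultimately show ?thesis
    using full_row_cols[OF P] w by (simp add: semi_perimeter_def width_def height_def
        nat_add_distrib)
qed

section \<open>Translation and normal form\<close>

lemma in_translate: "(x, y) \<in> translate v P \<longleftrightarrow> (x - fst v, y - snd v) \<in> P"
  by (force simp: translate_def)

lemma semi_perimeter_translate:
  assumes "finite P" "P \<noteq> {}"
  shows "semi_perimeter (translate v P) = semi_perimeter P"
proof -
  have "fst ` translate v P = (\<lambda>x. x + fst v) ` fst ` P" "snd ` translate v P = (\<lambda>x. x
      + snd v) ` snd ` P"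
    by (simp_all add: translate_def image_image)
  moreover have "Min ((\<lambda>x. x + c) ` S) = Min S + c" "Max ((\<lambda>x. x + c) ` S) = Max S + c"
    if "finite S" "S \<noteq> {}" for S :: "int set" and c
    using that by (simp_all add: mono_Min_commute[of "\<lambda>x. x
        + c" S, symmetric] mono_Max_commute[of "\<lambda>x. x + c" S, symmetric] mono_def)
  ultimately show ?thesis
    using assms by (simp add: semi_perimeter_def width_def height_def min_col_def max_col_def
        min_row_def max_row_def)
qed

lemma equiv_translation_equiv: "equiv UNIV translation_equiv"
proof (rule equivI)
  show "refl translation_equiv"
    by (auto simp: refl_on_def translation_equiv_def translate_def intro!: exI[of _ "0::int"])
  show "sym translation_equiv"
  proof (rule symI)
    fix P Q assume "(P, Q) \<in> translation_equiv"
    then obtain v where "Q = translate v P" by (auto simp: translation_equiv_def)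
    then have "P = translate (- fst v, - snd v) Q" by (auto simp: in_translate)
    then show "(Q, P) \<in> translation_equiv" by (auto simp: translation_equiv_def)
  qed
  show "trans translation_equiv"
  proof (rule transI)
    fix P Q R assume "(P, Q) \<in> translation_equiv" "(Q, R) \<in> translation_equiv"
    then obtain u v where "Q = translate u P" "R = translate v Q"
        by (auto simp: translation_equiv_def)
    then have "R = translate (fst u + fst v, snd u + snd v) P"
        by (auto simp: in_translate algebra_simps)
    then show "(P, R) \<in> translation_equiv" by (auto simp: translation_equiv_def)
  qed
qed (simp)

text \<open>Choosing the lowest full row makes the decomposition into two stacks canonical.\<close>

lemma full_row_lowest:
  assumes "full_row l r y0 P"
  shows "\<exists>y1. full_row l r y1 P \<and> \<not> (\<forall>x\<in>{l..r}. (x, y1 - 1) \<in> P)"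
proof -
  let ?F = "{y. \<forall>x\<in>{l..r}. (x, y) \<in> P}"
  have "l \<in> {l..r}" "finite P" "y0 \<in> ?F" using assms by (auto simp: full_row_def)
  then have "?F \<subseteq> snd ` P" by force
  then have "finite ?F" using \<open>finite P\<close> finite_subset by blast
  then have "Min ?F \<in> ?F" "Min ?F - 1 \<notin> ?F"
    using \<open>y0 \<in> ?F\<close> Min_in[of ?F] Min_le[of ?F "Min ?F - 1"] by auto
  then show ?thesis using assms by (intro exI[of _ "Min ?F"]) (simp add: full_row_def)
qed

lemma full_row_stack_decomposition:
  assumes P: "full_row l r y0 P"
  obtains I J where "nested_in 0 (r - l + 1) I" "nested_in 0 (r - l + 1) J"
    "P = translate (l, y0) (stack_polyomino (r - l + 1) I J)"
proof -
  let ?w = "r - l + 1"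
  have "finite (snd ` P)" using P by (simp add: full_row_def)
  \<comment> \<open>Rows at distance \<open>m\<close> or more from \<open>y0\<close> are empty,
    which bounds the lists to be constructed.\<close>
  then obtain m :: nat where m: "\<And>y. y \<in> snd ` P \<Longrightarrow> \<bar>y - y0\<bar> < int m"
  proof -
    assume *: "\<And>m. (\<And>y. y \<in> snd ` P \<Longrightarrow> \<bar>y - y0\<bar> < int m) \<Longrightarrow> thesis"
    have "\<bar>y - y0\<bar> < int (nat (Max ((\<lambda>y. \<bar>y - y0\<bar>) ` snd ` P) + 1))" if "y \<in> snd ` P" for y
    proof -
      have "\<bar>y - y0\<bar> \<le> Max ((\<lambda>y. \<bar>y - y0\<bar>) ` snd ` P)"
        using that \<open>finite (snd ` P)\<close> by (intro Max_ge) auto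
      then show ?thesis by simp
    qed
    then show thesis by (rule *)
  qed
  \<comment> \<open>The sign \<open>e\<close> treats the rows above and below \<open>y0\<close> at
    once.\<close>
  have exL: "\<exists>L. nested_in 0 ?w L \<and> (\<forall>k. {x. (x + l, y0 + e * (int k + 1)) \<in> P} = rows_of L k)"
    if e: "e = 1 \<or> e = -1" for e
  proof (rule rows_of_exists[where m = m])
    let ?S = "\<lambda>k. {x. (x + l, y0 + e * (int k + 1)) \<in> P}"
    show "?S (Suc k) \<subseteq> ?S k" for k
    proof
      fix x assume "x \<in> ?S (Suc k)"
      then have x: "(x + l, y0 + e * (int (Suc k) + 1)) \<in> P" by simp
      then have "(x + l, y0 + e * (int k + 1)) \<in> P"
        using e full_row_column[OF P x full_row_base[OF P x], of "y0 + e * (int k + 1)"]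
          full_row_column[OF P full_row_base[OF P x] x, of "y0 + e * (int k + 1)"] by auto
      then show "x \<in> ?S k" by simp
    qed
    show "contiguous (?S k)" for k
    proof -
      have "x \<in> ?S k" if "a \<in> ?S k" "b \<in> ?S k" "a \<le> x" "x \<le> b" for a b x
        using full_row_row[OF P, of "a + l" _ "b + l" "x + l"] that by simp
      then show ?thesis unfolding contiguous_def by (meson atLeastAtMost_iff subsetI)
    qed
    show "?S 0 \<subseteq> {0..<?w}"
    proof
      fix x assume "x \<in> ?S 0"
      then have "(x + l, y0 + e * (int 0 + 1)) \<in> P" by blast
      from full_row_x[OF P this] show "x \<in> {0..<?w}" by simp
    qed
    show "?S m = {}"
    proof (intro equals0I)
      fix x assume "x \<in> ?S m"
      then have "y0 + e * (int m + 1) \<in> snd ` P" by (force intro: rev_image_eqI)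
      from m[OF this] e show False by auto
    qed
  qed
  obtain I where I: "nested_in 0 ?w I" "\<And>k. {x. (x + l, y0 + 1 * (int k + 1)) \<in> P} = rows_of I k"
    using exL[OF disjI1[OF refl]] by blast
  obtain J where J: "nested_in 0 ?w J" "\<And>k. {x. (x + l, y0 + (-1) * (int k + 1)) \<in> P} = rows_of J k"
    using exL[OF disjI2[OF refl]] by blast
  have "(x, y) \<in> P \<longleftrightarrow> (x - l, y - y0) \<in> stack_polyomino ?w I J" for x y
  proof -
    consider "y = y0" | "y > y0" | "y < y0" by linarith
    then show ?thesis
    proof cases
      case 1
      have "(x, y0) \<in> P \<longleftrightarrow> l \<le> x \<and> x \<le> r"
        using full_row_x[OF P, of x y0] P unfolding full_row_def by (meson atLeastAtMost_iff)
      then show ?thesis using 1 by (simp add: stack_polyomino_def)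
    next
      case 2
      have "y0 + 1 * (int (nat (y - y0 - 1)) + 1) = y" using 2 by simp
      then have "(x, y) \<in> P \<longleftrightarrow> x - l \<in> rows_of I (nat (y - y0 - 1))"
        unfolding I(2)[symmetric] mem_Collect_eq by simp
      moreover have "- (y - y0) - 1 = y0 - y - 1" by simp
      ultimately show ?thesis using 2 by (simp add: stack_polyomino_def)
    next
      case 3
      have "y0 + (-1) * (int (nat (y0 - y - 1)) + 1) = y" using 3 by simp
      then have "(x, y) \<in> P \<longleftrightarrow> x - l \<in> rows_of J (nat (y0 - y - 1))"
        unfolding J(2)[symmetric] mem_Collect_eq by simp
      moreover have "- (y - y0) - 1 = y0 - y - 1" by simp
      ultimately show ?thesis using 3 by (simp add: stack_polyomino_def)
    qed
  qed
  then have "P = translate (l, y0) (stack_polyomino ?w I J)" by (simp add: set_eq_iff in_translate)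
  then show thesis by (rule that[OF I(1) J(1)])
qed

subsection \<open>Counting translation classes\<close>

text \<open>A list \<open>J\<close> starting with \<open>(0, w - 1)\<close> would make row \<open>-1\<close> full, while row \<open>0\<close> has to be the lowest
  full row.\<close>

definition low_stack_pairs :: "int \<Rightarrow> nat \<Rightarrow> ((int \<times> int) list \<times> (int \<times> int) list) set" where
  "low_stack_pairs w k = {(I, J) \<in> stack_pairs 0 w 0 w k. \<forall>J'. J \<noteq> (0, w - 1) # J'}"

lemma finite_low_stack_pairs: "finite (low_stack_pairs w k)"
  by (rule finite_subset[OF _ finite_stack_pairs[of 0 w 0 w k]]) (auto simp: low_stack_pairs_def)

lemma card_low_stack_pairs_0: "card (low_stack_pairs w 0) = 1"
proof -
  have "low_stack_pairs w 0 = {([], [])}"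
    unfolding low_stack_pairs_def stack_pairs_0 by auto
  then show ?thesis by simp
qed

text \<open>Putting the full interval in front of \<open>J\<close> preserves nestedness and
  compatibility, so the excluded pairs correspond to all pairs with one interval less.\<close>

lemma card_low_stack_pairs_Suc:
  assumes "1 \<le> w"
  shows "int (card (low_stack_pairs (int w) (Suc k))) = pair_count (Suc k) w w - pair_count k w w"
proof -
  let ?g = "\<lambda>(I, J). (I :: (int \<times> int) list, (0, int w - 1) # J)"
  let ?S = "stack_pairs 0 (int w) 0 (int w)"
  have mem: "(I, (0, int w - 1) # J) \<in> ?S (Suc k) \<longleftrightarrow> (I, J) \<in> ?S k" for I J
  proof -
    have "\<forall>p\<in>set I. \<not> fst p < 0" if "nested_in 0 (int w) I"
      using that by (auto simp: nested_in_def not_less)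
    then show ?thesis using assms by (auto simp: stack_pairs_def nested_in_Cons compatible_def)
  qed
  have "?S (Suc k) = low_stack_pairs (int w) (Suc k) \<union> ?g ` ?S k"
  proof (intro set_eqI)
    fix x :: "(int \<times> int) list \<times> (int \<times> int) list"
    obtain I J where [simp]: "x = (I, J)" by (cases x)
    have "(I, J) \<in> ?g ` ?S k \<longleftrightarrow> (\<exists>J'. J = (0, int w - 1) # J' \<and> (I, J') \<in> ?S k)" by force
    then show "x \<in> ?S (Suc k) \<longleftrightarrow> x \<in> low_stack_pairs (int w) (Suc k) \<union> ?g ` ?S k"
      using mem by (auto simp: low_stack_pairs_def)
  qed
  moreover have "low_stack_pairs (int w) (Suc k) \<inter> ?g ` ?S k = {}"
    by (auto simp: low_stack_pairs_def)
  ultimately have "card (?S (Suc k)) = card (low_stack_pairs (int w) (Suc k)) + card (?g ` ?S k)"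
    using finite_low_stack_pairs finite_stack_pairs by (simp add: card_Un_disjoint)
  moreover have "card (?g ` ?S k) = card (?S k)" by (rule card_image) (auto simp: inj_on_def)
  ultimately show ?thesis by (simp add: pair_count_def)
qed

lemma stack_polyomino_lowest:
  assumes "nested_in 0 w J" "1 \<le> w"
  shows "(\<forall>x\<in>{0..w - 1}. (x, -1) \<in> stack_polyomino w I J) \<longleftrightarrow> (\<exists>J'. J = (0, w - 1) # J')"
proof -
  have "(x, -1) \<in> stack_polyomino w I J \<longleftrightarrow> x \<in> rows_of J 0" for x
    by (simp add: stack_polyomino_def)
  moreover have "(\<forall>x\<in>{0..w - 1}. x \<in> rows_of J 0) \<longleftrightarrow> (\<exists>J'. J = (0, w - 1) # J')"
  proof (cases J)
    case Nil
    then show ?thesis using assms(2) by auto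
  next
    case (Cons p J')
    have "(\<forall>x\<in>{0..w - 1}. x \<in> {fst p..snd p}) \<longleftrightarrow> fst p = 0 \<and> snd p = w - 1"
    proof
      assume *: "\<forall>x\<in>{0..w - 1}. x \<in> {fst p..snd p}"
      have "0 \<in> {0..w - 1}" "w - 1 \<in> {0..w - 1}" using assms(2) by auto
      then have "0 \<in> {fst p..snd p}" "w - 1 \<in> {fst p..snd p}" using * by blast+
      then show "fst p = 0 \<and> snd p = w - 1"
        using assms(1) Cons by (auto simp: nested_in_Cons)
    qed auto
    then show ?thesis using Cons by (simp add: rows_of_Cons prod_eq_iff)
  qed
  ultimately show ?thesis by simp
qed

lemma stack_polyomino_translate_inj:
  assumes IJ: "nested_in 0 w I" "nested_in 0 w J" "1 \<le> w" "\<forall>J''. J \<noteq> (0, w - 1) # J''"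
    and IJ': "nested_in 0 w' I'" "nested_in 0 w' J'" "1 \<le> w'" "\<forall>J''. J' \<noteq> (0, w' - 1) # J''"
    and eq: "stack_polyomino w' I' J' = translate v (stack_polyomino w I J)"
  shows "w = w' \<and> I = I' \<and> J = J'"
proof -
  let ?P = "stack_polyomino w I J" and ?P' = "stack_polyomino w' I' J'"
  note P = full_row_stack_polyomino[OF IJ(1-3)] and P' = full_row_stack_polyomino[OF IJ'(1-3)]
  have eq': "(x, y) \<in> ?P' \<longleftrightarrow> (x - fst v, y - snd v) \<in> ?P" for x y
    unfolding eq by (rule in_translate)
  \<comment> \<open>Comparing the ends of each row 0 with the column range of the other polyomino
    fixes the horizontal offset and the width.\<close>
  have "(0, 0) \<in> ?P" "(w - 1, 0) \<in> ?P" using IJ(3) by (simp_all add: stack_polyomino_def)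
  then have "(fst v, snd v) \<in> ?P'" "(w - 1 + fst v, snd v) \<in> ?P'"
    by (simp_all add: eq' del: prod.collapse)
  from full_row_x[OF P' this(1)] full_row_x[OF P' this(2)]
  have 1: "0 \<le> fst v" "w - 1 + fst v \<le> w' - 1" by auto
  have "(0, 0) \<in> ?P'" "(w' - 1, 0) \<in> ?P'" using IJ'(3) by (simp_all add: stack_polyomino_def)
  then have "(- fst v, - snd v) \<in> ?P" "(w' - 1 - fst v, - snd v) \<in> ?P" by (simp_all add: eq')
  from full_row_x[OF P this(1)] full_row_x[OF P this(2)]
  have 2: "fst v = 0" "w' = w" using 1 by auto
  \<comment> \<open>A full row below row 0 would, by contiguity of the columns, make row -1
    full.\<close>
  have lowest: "0 \<le> y" if "\<forall>x\<in>{0..u - 1}. (x, y) \<in> stack_polyomino u K L"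
    "nested_in 0 u K" "nested_in 0 u L" "1 \<le> u" "\<forall>J''. L \<noteq> (0, u - 1) # J''" for u K L y
  proof (rule ccontr)
    assume "\<not> 0 \<le> y"
    then have "(x, -1) \<in> stack_polyomino u K L" if "x \<in> {0..u - 1}" for x
      using full_row_column[OF full_row_stack_polyomino, of u K L x y 0 "-1"] that
        \<open>\<forall>x\<in>{0..u - 1}. (x, y) \<in> stack_polyomino u K L\<close>
        \<open>nested_in 0 u K\<close> \<open>nested_in 0 u L\<close> \<open>1 \<le> u\<close> by (simp add: stack_polyomino_def)
    then show False using stack_polyomino_lowest[of u L K] that by blast
  qed
  \<comment> \<open>Row \<open>snd v\<close> of \<open>?P'\<close> and row \<open>- snd v\<close> of
    \<open>?P\<close> are both full, so \<open>snd v\<close> can be neither negative nor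
    positive.\<close>
  have "\<forall>x\<in>{0..w' - 1}. (x, snd v) \<in> ?P'"
  proof
    fix x assume "x \<in> {0..w' - 1}"
    then have "(x, 0) \<in> ?P" using 2 by (simp add: stack_polyomino_def)
    then show "(x, snd v) \<in> ?P'" using eq'[of x "snd v"] 2 by simp
  qed
  moreover have "\<forall>x\<in>{0..w - 1}. (x, - snd v) \<in> ?P"
  proof
    fix x assume "x \<in> {0..w - 1}"
    then have "(x, 0) \<in> ?P'" using 2 by (simp add: stack_polyomino_def)
    then show "(x, - snd v) \<in> ?P" using eq'[of x 0] 2 by simp
  qed
  ultimately have "snd v = 0" using lowest IJ IJ' by (metis add.inverse_neutral neg_0_le_iff_le
      order_antisym)
  then have same: "(x, y) \<in> ?P' \<longleftrightarrow> (x, y) \<in> ?P" for x y using eq' 2 by simp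
  have "rows_of I k = rows_of I' k" "rows_of J k = rows_of J' k" for k
    using same[of _ "int k + 1"] same[of _ "- int k - 1"]
    by (auto simp: set_eq_iff stack_polyomino_def)
  then show ?thesis using 2 rows_of_inj[OF IJ(1) IJ'(1)] rows_of_inj[OF IJ(2) IJ'(2)] by simp
qed

text \<open>Each class has exactly one representative whose lowest full row is row 0, starting in
  column 0. Width \<open>w\<close> and semi-perimeter \<open>n\<close> leave
  \<open>n - 1 - w\<close> rows besides the full one.\<close>

lemma h_eq_sum: "h n = (\<Sum>w\<in>{1..<n}. card (low_stack_pairs (int w) (n - 1 - w)))"
proof -
  let ?A = "{P. ascending P \<and> centered P \<and> semi_perimeter P = n}"
  let ?S = "Sigma {1..<n} (\<lambda>w. low_stack_pairs (int w) (n - 1 - w))"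
  let ?f = "\<lambda>(w, I, J). translation_equiv `` {stack_polyomino (int w) I J}"
  have low: "nested_in 0 (int w) I \<and> nested_in 0 (int w) J \<and> compatible I J \<and> 1 \<le> int w \<and>
      length I + length J = n - 1 - w \<and> w < n \<and> (\<forall>J'. J \<noteq> (0, int w - 1) # J')"
    if "(w, I, J) \<in> ?S" for w I J
    using that by (simp add: low_stack_pairs_def stack_pairs_def)
  have bij: "bij_betw ?f ?S (?A // translation_equiv)"
    unfolding bij_betw_def
  proof (intro conjI equalityI subsetI)
    show "inj_on ?f ?S"
    proof (rule inj_onI)
      fix s s' assume s: "s \<in> ?S" "s' \<in> ?S" "?f s = ?f s'"
      obtain w I J w' I' J' where [simp]: "s = (w, I, J)" "s' = (w', I', J')" by (metis prod_cases3)
      have "(stack_polyomino (int w) I J, stack_polyomino (int w') I' J') \<in> translation_equiv"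
        using s(3) eq_equiv_class_iff[OF equiv_translation_equiv] by simp
      then obtain v where "stack_polyomino (int w') I' J'
          = translate v (stack_polyomino (int w) I J)"
        by (auto simp: translation_equiv_def)
      then show "s = s'"
        using stack_polyomino_translate_inj[of "int w" I J "int w'" I' J' v] low[of w I J] low[of
            w' I' J'] s(1,2)
        by simp
    qed
  next
    fix X assume "X \<in> ?f ` ?S"
    then obtain w I J where X: "X = translation_equiv `` {stack_polyomino (int w) I J}" "(w, I, J)
        \<in> ?S"
      by auto
    note l = low[OF X(2)]
    then have "ascending (stack_polyomino (int w) I J)" by (simp add: ascending_stack_polyomino)
    moreover have "centered (stack_polyomino (int w) I J)"
      using full_row_centered[OF full_row_stack_polyomino] l by blast
    moreover have "semi_perimeter (stack_polyomino (int w) I J) = w + length I + length J + 1"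
      using l by (simp add: semi_perimeter_stack_polyomino)
    then have "semi_perimeter (stack_polyomino (int w) I J) = n" using l by linarith
    ultimately show "X \<in> ?A // translation_equiv" unfolding X(1) by (intro quotientI) simp
  next
    fix X assume "X \<in> ?A // translation_equiv"
    then obtain Q where X: "X = translation_equiv `` {Q}"
      and Q: "ascending Q" "centered Q" "semi_perimeter Q = n"
      by (auto elim: quotientE)
    obtain y0 where "full_row (min_col Q) (max_col Q) y0 Q"
      using centered_full_row[of Q] Q by (auto simp: ascending_def)
    then obtain l r y1 where F: "full_row l r y1 Q" "\<not> (\<forall>x\<in>{l..r}. (x, y1 - 1) \<in> Q)"
      using full_row_lowest by blast
    obtain I J where IJ: "nested_in 0 (r - l + 1) I" "nested_in 0 (r - l + 1) J"
      "Q = translate (l, y1) (stack_polyomino (r - l + 1) I J)"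
      using full_row_stack_decomposition[OF F(1)] by blast
    define w where "w = nat (r - l + 1)"
    have w: "r - l + 1 = int w" "1 \<le> int w" using F(1) by (auto simp: w_def full_row_def)
    let ?P = "stack_polyomino (int w) I J"
    note IJ = IJ[unfolded w(1)]
    note P = full_row_stack_polyomino[OF IJ(1,2) w(2)]
    have QP: "(x, y) \<in> ?P \<longleftrightarrow> (x + l, y + y1) \<in> Q" for x y
      unfolding IJ(3) by (simp add: in_translate)
    have "ascending ?P"
      unfolding full_row_ascending_iff[OF P]
    proof (intro allI impI)
      fix x y x' y' assume "(x, y) \<in> ?P" "(x', y') \<in> ?P" "x' < x" "y < 0" "0 < y'"
      then show "(x', y) \<in> ?P \<or> (x, y') \<in> ?P"
        using Q(1)[unfolded full_row_ascending_iff[OF F(1)], rule_format, of "x + l" "y + y1" "x'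
            + l" "y' + y1"]
        by (simp add: QP)
    qed
    then have compatible: "compatible I J" using ascending_stack_polyomino[OF IJ(1,2) w(2)] by simp
    have "(0, 0) \<in> ?P" using w(2) by (simp add: stack_polyomino_def)
    then have "?P \<noteq> {}" by blast
    moreover have "finite ?P" using P by (simp add: full_row_def)
    ultimately have "semi_perimeter ?P = n" using Q(3) unfolding IJ(3)
        by (simp add: semi_perimeter_translate)
    then have len: "w + length I + length J + 1 = n"
      using semi_perimeter_stack_polyomino[OF IJ(1,2) w(2)] by simp
    have "\<forall>J'. J \<noteq> (0, int w - 1) # J'"
    proof -
      obtain x where x: "x \<in> {l..r}" "(x, y1 - 1) \<notin> Q" using F(2) by blast
      then have "x - l \<in> {0..int w - 1}" "(x - l, -1) \<notin> ?P" using w by (auto simp: QP)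
      then show ?thesis using stack_polyomino_lowest[OF IJ(2) w(2)] by blast
    qed
    then have "(w, I, J) \<in> ?S"
      using IJ(1,2) w(2) compatible len by (auto simp: low_stack_pairs_def stack_pairs_def)
    moreover have "X = ?f (w, I, J)"
    proof -
      have "(?P, Q) \<in> translation_equiv" using IJ(3) by (auto simp: translation_equiv_def)
      then show ?thesis unfolding X using equiv_class_eq[OF equiv_translation_equiv] by simp
    qed
    ultimately show "X \<in> ?f ` ?S" by (rule rev_image_eqI)
  qed
  have "h n = card ?S" unfolding h_def by (rule bij_betw_same_card[OF bij, symmetric])
  also have "\<dots> = (\<Sum>w\<in>{1..<n}. card (low_stack_pairs (int w) (n - 1 - w)))"
    by (simp add: card_SigmaI finite_low_stack_pairs)
  finally show ?thesis .
qed

text \<open>Here \<open>m - k\<close> is the width, and the semi-perimeter is \<open>m + 1\<close>.\<close>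

definition marked_count :: "nat \<Rightarrow> int" where
  "marked_count m = (\<Sum>k<m. pair_count k (m - k) (m - k))"

lemma marked_count_0 [simp]: "marked_count 0 = 0"
  by (simp add: marked_count_def)

lemma marked_count_Suc: "marked_count (Suc m) = int ((2 * m + 1) choose Suc m)"
proof -
  have "pair_count k (Suc m - k) (Suc m - k) = int ((m choose k) * (Suc m choose (Suc m - k)))" if
      "k \<le> m" for k
  proof -
    have "pair_count k (Suc (m - k)) (Suc (m - k)) = int (m choose k) * int (Suc m choose k)"
      using pair_count_solution[of "Suc (m - k)"] that multichoose_binomial[of "m - k" k]
          multichoose_binomial[of "Suc (m - k)" k]
      by simp
    then show ?thesis using that binomial_symmetric[of k "Suc m"] by (simp add: Suc_diff_le)
  qed
  then have "marked_count (Suc m) = (\<Sum>k\<le>m. int ((m choose k) * (Suc m choose (Suc m - k))))"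
    unfolding marked_count_def lessThan_Suc_atMost by (intro sum.cong refl) auto
  \<comment> \<open>The added term vanishes because \<open>m choose Suc m\<close> is 0.\<close>
  also have "\<dots> = int (\<Sum>k\<le>Suc m. (m choose k) * (Suc m choose (Suc m - k)))"
    by (simp add: binomial_eq_0)
  also have "(\<Sum>k\<le>Suc m. (m choose k) * (Suc m choose (Suc m - k))) = (m + Suc m) choose Suc m"
    by (rule vandermonde)
  finally show ?thesis by (simp add: mult_2)
qed

text \<open>The pairs subtracted for each width have one row less, hence a semi-perimeter smaller by
  one; together they give \<open>marked_count m\<close>.\<close>

lemma h_marked_count: "int (h (Suc (Suc m))) = marked_count (Suc m) - marked_count m"
proof -
  let ?c = "\<lambda>k. int (card (low_stack_pairs (int (Suc m - k)) k))"
  have "int (h (Suc (Suc m))) = (\<Sum>w\<in>{1..<Suc (Suc m)}. int (card (low_stack_pairs (int w) (Suc m -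
      w))))"
    unfolding h_eq_sum by simp
  also have "\<dots> = (\<Sum>k<Suc m. ?c k)"
    by (rule sum.reindex_bij_witness[where i = "\<lambda>k. Suc m - k" and j = "\<lambda>w. Suc m - w"]) auto
  also have "\<dots> = ?c 0 + (\<Sum>k<m. ?c (Suc k))" by (rule sum.lessThan_Suc_shift)
  also have "?c 0 = 1" by (simp add: card_low_stack_pairs_0)
  also have "(\<Sum>k<m. ?c (Suc k)) = (\<Sum>k<m. pair_count (Suc k) (m - k) (m - k) - pair_count k (m - k)
      (m - k))"
  proof (intro sum.cong refl)
    fix k assume "k \<in> {..<m}"
    then show "?c (Suc k) = pair_count (Suc k) (m - k) (m - k) - pair_count k (m - k) (m - k)"
      using card_low_stack_pairs_Suc[of "m - k" k] by simp
  qed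
  also have "\<dots> = (\<Sum>k<m. pair_count (Suc k) (m - k) (m - k)) - marked_count m"
    by (simp add: sum_subtractf marked_count_def)
  \<comment> \<open>The 1 is the term \<open>k = 0\<close> of \<open>marked_count (Suc m)\<close>, a
    single full row.\<close>
  also have "1 + \<dots> = marked_count (Suc m) - marked_count m"
    unfolding marked_count_def sum.lessThan_Suc_shift by simp
  finally show ?thesis .
qed

theorem theorem3:
  fixes n :: nat
  assumes "n \<ge> 2"
  shows "real (h n) = (3 * real n - 5) / (real n - 1) * ((2 * real n - 5) gchoose (n - 2))"
proof -
  show ?thesis
  \<comment> \<open>For \<open>n = 2\<close> the subtracted term is \<open>marked_count 0\<close>,
    which is not covered by \<open>marked_count_Suc\<close>; \<open>gchoose 0\<close> is 1, in line
    with the convention.\<close>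
  proof (cases "n = 2")
    case True
    then have "h n = 1" using h_marked_count[of 0] marked_count_Suc[of 0]
        by (simp add: numeral_2_eq_2)
    then show ?thesis using True by simp
  next
    case False
    define j where "j = n - 3"
    have n: "n = Suc (Suc (Suc j))" using assms False by (simp add: j_def)
    define B c where "B = real ((2 * Suc j + 1) choose Suc (Suc j))" and "c = real ((2 * j
        + 1) choose Suc j)"
    have "int (h n) = int ((2 * Suc j + 1) choose Suc (Suc j)) - int ((2 * j + 1) choose Suc j)"
      unfolding n h_marked_count marked_count_Suc ..
    from arg_cong[OF this, of real_of_int] have h: "real (h n) = B - c"
      by (simp only: of_int_diff of_int_of_nat_eq B_def c_def)
    have e: "2 * Suc j + 1 = Suc (2 * j + 2)" "2 * j + 2 = Suc (2 * j + 1)" "2 * j + 1 - j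
        = Suc j" by simp_all
    \<comment> \<open>Absorption expresses \<open>B\<close> through a central binomial coefficient,
      which is twice \<open>c\<close>; thus \<open>B - c\<close> is a rational multiple of
      \<open>c\<close>.\<close>
    have "Suc (Suc j) * ((2 * Suc j + 1) choose Suc (Suc j)) = Suc (2 * j + 2) * ((2 * j
        + 2) choose Suc j)"
      unfolding e(1) by (rule Suc_times_binomial)
    also have "(2 * j + 2) choose Suc j = 2 * ((2 * j + 1) choose Suc j)"
      using binomial_symmetric[of j "2 * j + 1"] unfolding e(2) binomial_Suc_Suc e(3) by simp
    finally have "real (Suc (Suc j)) * B = real (Suc (2 * j + 2)) * (2 * c)"
      unfolding B_def c_def by (metis of_nat_mult of_nat_numeral)
    then have "(real j + 2) * B = (2 * real j + 3) * (2 * c)" by (simp add: add.commute)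
    then have "(real j + 2) * (B - c) = (3 * real j + 4) * c" by (simp add: algebra_simps)
    then have "B - c = (3 * real j + 4) / (real j + 2) * c"
      by (simp add: nonzero_eq_divide_eq mult.commute)
    moreover have "(2 * real n - 5) gchoose (n - 2) = c"
    proof -
      have "2 * real n - 5 = real (2 * j + 1)" "n - 2 = Suc j" using n by auto
      then show ?thesis by (simp only: binomial_gbinomial c_def)
    qed
    moreover have "3 * real n - 5 = 3 * real j + 4" "real n - 1 = real j + 2" using n by auto
    ultimately show ?thesis using h by (simp only:)
  qed
qed

end
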